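(* Let $\mathcal{H}$ be a Hilbert space and let $P,Q\in L(\mathcal{H})$ be orthogonal projections. Then there exists an orthogonal projection $H\in L(\mathcal{H})$ which is a solution $X=H$ of the equation $$(PQP)^{1/2}=PXP.$$ Moreover, all the orthogonal projections which are solutions of this equation are parametrized, in terms of matrices with respect to the decomposition $\mathcal{H}=R(P)\oplus N(P)$, as $$H=\begin{pmatrix}A & A^{1/2}(P-A)^{1/2}U^*\\ UA^{1/2}(P-A)^{1/2} & U(P-A)U^*+\hat{H}\end{pmatrix},$$ where $A=(PQP)^{1/2}$, $U$ is a partial isometry with initial space $\overline{R(A(P-A))}$ and final space $\mathcal{W}\subseteq N(P)$, and $\hat{H}$ is an orthogonal projection with $R(\hat{H})\subseteq N(P)\ominus R(U)$.
   Context: $L(\mathcal{H})$ is the algebra of bounded linear operators on $\mathcal{H}$; $R(\cdot)$ and $N(\cdot)$ denote range and nullspace. $N(P)\ominus R(U)$ is the orthogonal complement of $R(U)$ in $N(P)$. The initial space of a partial isometry $U$ is $N(U)^\perp$ and its final space is $R(U)$. Matrix entries are operators on $\mathcal{H}$ regarded as acting between the corresponding summands; equivalently, $H$ is the sum of the four entries as operators on $\mathcal{H}$. *)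

theory Defs
  imports "HOL-Analysis.Analysis"
begin

text \<open>
  Complex Hilbert spaces, without a separability assumption. The inner product \<open>cinner\<close> is linear
  in its first argument. Its real part is the library's real inner product, so that norm,
  completeness and topology are the library's; positive definiteness of \<open>cinner\<close> is inherited
  from \<open>real_inner\<close>.
\<close>

class complex_hilbert = real_inner + complete_space +
  fixes scaleC :: "complex \<Rightarrow> 'a \<Rightarrow> 'a"
    and cinner :: "'a \<Rightarrow> 'a \<Rightarrow> complex"
  assumes scaleC_add_right: "scaleC c (x + y) = scaleC c x + scaleC c y"
    and scaleC_add_left: "scaleC (c + d) x = scaleC c x + scaleC d x"
    and scaleC_scaleC: "scaleC c (scaleC d x) = scaleC (c * d) x"
    and scaleC_of_real: "scaleC (complex_of_real r) x = r *\<^sub>R x"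
    and cinner_commute: "cinner x y = cnj (cinner y x)"
    and cinner_add_left: "cinner (x + y) z = cinner x z + cinner y z"
    and cinner_scaleC_left: "cinner (scaleC c x) y = c * cinner x y"
    and Re_cinner: "Re (cinner x y) = x \<bullet> y"

instantiation complex :: complex_hilbert
begin

definition scaleC_complex :: "complex \<Rightarrow> complex \<Rightarrow> complex"
  where "scaleC_complex c x = c * x"

definition cinner_complex :: "complex \<Rightarrow> complex \<Rightarrow> complex"
  where "cinner_complex x y = x * cnj y"

instance
  by standard
    (simp_all add: scaleC_complex_def cinner_complex_def algebra_simps inner_complex_def
      scaleR_conv_of_real)

end

text \<open>
  Operators have the library type of bounded real-linear maps; \<open>L(H)\<close> is the subset of the
  complex-linear ones.
\<close>

definition operators :: "('a::complex_hilbert \<Rightarrow>\<^sub>L 'a) set"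
  where "operators = {T. \<forall>c x. blinfun_apply T (scaleC c x) = scaleC c (blinfun_apply T x)}"

definition op_range :: "('a::complex_hilbert \<Rightarrow>\<^sub>L 'a) \<Rightarrow> 'a set"
  where "op_range T = range (blinfun_apply T)"

definition op_kernel :: "('a::complex_hilbert \<Rightarrow>\<^sub>L 'a) \<Rightarrow> 'a set"
  where "op_kernel T = {x. T x = 0}"

definition ocompl :: "'a::complex_hilbert set \<Rightarrow> 'a set"
  where "ocompl S = {x. \<forall>y\<in>S. cinner x y = 0}"

text \<open>For complex-linear \<open>T\<close> the adjoint exists (and is unique) by the Riesz theorem.\<close>

definition adj :: "('a::complex_hilbert \<Rightarrow>\<^sub>L 'a) \<Rightarrow> ('a \<Rightarrow>\<^sub>L 'a)"
  where "adj T = (THE S. \<forall>x y. cinner (T x) y = cinner x (blinfun_apply S y))"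

definition orth_projection :: "('a::complex_hilbert \<Rightarrow>\<^sub>L 'a) \<Rightarrow> bool"
  where "orth_projection P \<longleftrightarrow> P \<in> operators \<and> P o\<^sub>L P = P \<and> adj P = P"

definition positive_op :: "('a::complex_hilbert \<Rightarrow>\<^sub>L 'a) \<Rightarrow> bool"
  where "positive_op T \<longleftrightarrow> T \<in> operators \<and> (\<forall>x. cinner (T x) x \<in> \<real>\<^sub>\<ge>\<^sub>0)"

text \<open>The unique positive square root; meaningful only when \<open>T\<close> is positive.\<close>

definition sqrt_op :: "('a::complex_hilbert \<Rightarrow>\<^sub>L 'a) \<Rightarrow> ('a \<Rightarrow>\<^sub>L 'a)"
  where "sqrt_op T = (THE S. positive_op S \<and> S o\<^sub>L S = T)"

definition partial_isometry :: "('a::complex_hilbert \<Rightarrow>\<^sub>L 'a) \<Rightarrow> bool"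
  where "partial_isometry U \<longleftrightarrow>
    U \<in> operators \<and> (\<forall>x \<in> ocompl (op_kernel U). norm (U x) = norm x)"

definition initial_space :: "('a::complex_hilbert \<Rightarrow>\<^sub>L 'a) \<Rightarrow> 'a set"
  where "initial_space U = ocompl (op_kernel U)"

definition final_space :: "('a::complex_hilbert \<Rightarrow>\<^sub>L 'a) \<Rightarrow> 'a set"
  where "final_space U = op_range U"

text \<open>
  The operator with matrix \<open>(a b; c d)\<close> with respect to \<open>R(P) \<oplus> N(P)\<close>, where an entry acting
  between two summands is identified with its extension by zero to the whole space. Under this
  identification the operator is the sum of its entries, whatever \<open>P\<close> is.
\<close>

definition op_matrix ::
    "('a::complex_hilbert \<Rightarrow>\<^sub>L 'a) \<Rightarrow> ('a \<Rightarrow>\<^sub>L 'a) \<Rightarrow> ('a \<Rightarrow>\<^sub>L 'a) \<Rightarrow> ('a \<Rightarrow>\<^sub>L 'a) \<Rightarrow> ('a \<Rightarrow>\<^sub>L 'a)"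
  where "op_matrix a b c d = a + b + c + d"

end

theory Submission
  imports Defs
begin

text \<open>
  Let \<open>A = (PQP)\<^sup>1\<^sup>/\<^sup>2\<close>. A projection \<open>H\<close> with \<open>PHP = A\<close> has off-diagonal corner \<open>C = (1 - P)HP\<close> with
  \<open>C\<^sup>*C = PHP - (PHP)\<^sup>2 = A(P - A)\<close>, so the polar decomposition of \<open>C\<close> supplies \<open>U\<close>, and
  \<open>H\<^sup>2 = H\<close> forces the remaining corner to be \<open>U(P - A)U\<^sup>*\<close> plus a projection. Conversely, the matrix
  equals \<open>WW\<^sup>* + H'\<close> with \<open>W = A\<^sup>1\<^sup>/\<^sup>2 + U(P - A)\<^sup>1\<^sup>/\<^sup>2\<close> a partial isometry and \<open>H'W = 0\<close>. An
  admissible \<open>U\<close> always exists: the corner \<open>(1 - P)QP\<close> of \<open>Q\<close> has modulus \<open>(A\<^sup>2 - A\<^sup>4)\<^sup>1\<^sup>/\<^sup>2\<close>, whose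
  kernel is that of \<open>A(P - A)\<close>.

  For complex-linear operators, adjoints, symmetry, positivity and orthogonality can all be read off
  the real inner product, which is used throughout.
\<close>

text \<open>In general \<open>Q\<close> is not itself a solution: it compresses to
  \<open>A\<^sup>2\<close>, not to \<open>A\<close>. What it supplies is room, an isometric copy
  inside \<open>N(P)\<close> of the closure of \<open>R(A(P - A))\<close>. \<open>W\<close> is a
  partial isometry although \<open>A\<close> need not be a projection:
  \<open>W\<^sup>*W = A + U\<^sup>*U(P - A)\<close>. On the closure of \<open>R(A(P - A))\<close>,
  where \<open>U\<^sup>*U\<close> is the identity, this is \<open>P\<close>; on the kernel of
  \<open>A(P - A)\<close>, where \<open>U\<close> vanishes, it is \<open>A\<close>, which is
  idempotent there. This splitting of the space takes the place of functional calculus for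
  \<open>A\<close>. In the other direction put \<open>D = (1 - P)H(1 - P)\<close>. The lower entries
  of \<open>H\<^sup>2 = H\<close> read \<open>CA + DC = C\<close> and
  \<open>CC\<^sup>* + D\<^sup>2 = D\<close>. Cancelling the modulus of \<open>C\<close> in the first
  gives \<open>DU = U(P - A)\<close>, so \<open>D - U(P - A)U\<^sup>*\<close> annihilates
  \<open>R(U)\<close>; the second then makes it idempotent.\<close>

instance complex_hilbert \<subseteq> banach ..

section \<open>Riesz representation on closed subspaces\<close>

text \<open>The representing vector minimises \<open>norm x ^ 2 - 2 * f x\<close> over \<open>M\<close>; its minimising sequences are
  Cauchy by the parallelogram law.\<close>

lemma riesz_on_closed_subspace:
  fixes M :: "'a::{real_inner,complete_space} set" and f :: "'a \<Rightarrow> real"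
  assumes M: "subspace M" "closed M" and f: "bounded_linear f"
  obtains s where "s \<in> M" "\<And>v. v \<in> M \<Longrightarrow> f v = v \<bullet> s"
proof -
  interpret f: bounded_linear f by fact
  \<comment> \<open>If \<open>s\<close> in \<open>M\<close> represents \<open>f\<close> on
    \<open>M\<close>, then on \<open>M\<close> the value \<open>J x\<close> is the squared distance
    from \<open>x\<close> to \<open>s\<close> minus \<open>s \<bullet> s\<close>. So the vector
    sought has to be the minimiser.\<close>
  define J where "J x = x \<bullet> x - 2 * f x" for x
  obtain K where K: "\<And>x. \<bar>f x\<bar> \<le> norm x * K"
    using f.bounded by auto
  have J_lower: "- K\<^sup>2 \<le> J x" for x
  proof -
    have "0 \<le> (norm x - K)\<^sup>2" by simp
    also have "\<dots> = x \<bullet> x - 2 * (norm x * K) + K\<^sup>2"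
      by (simp add: power2_diff dot_square_norm)
    finally show ?thesis
      using K[of x] by (simp add: J_def)
  qed
  define m where "m = Inf (J ` M)"
  have bdd: "bdd_below (J ` M)"
    using J_lower by (auto intro!: bdd_belowI)
  have ne: "J ` M \<noteq> {}"
    using subspace_0[OF M(1)] by auto
  have m_le: "m \<le> J x" if "x \<in> M" for x
    unfolding m_def using bdd that by (auto intro!: cInf_lower)
  have "\<exists>x\<in>M. J x < m + inverse (real (Suc n))" for n
  proof -
    have "Inf (J ` M) < m + inverse (real (Suc n))"
      unfolding m_def[symmetric] by simp
    from cInf_lessD[OF ne this] show ?thesis by auto
  qed
  then obtain X where XM: "\<And>n. X n \<in> M" and XJ: "\<And>n. J (X n) < m + inverse (real (Suc n))"
    by metis
  have par: "(norm (x - y))\<^sup>2 \<le> 2 * (J x - m) + 2 * (J y - m)" if "x \<in> M" "y \<in> M" for x y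
  proof -
    define z where "z = (1/2) *\<^sub>R (x + y)"
    have "z \<in> M"
      unfolding z_def using that M(1) by (intro subspace_scale subspace_add)
    note m_le[OF this]
    moreover have "4 * J z = 2 * J x + 2 * J y - (norm (x - y))\<^sup>2"
      by (simp add: z_def J_def f.scaleR f.add power2_norm_eq_inner inner_simps inner_commute
          algebra_simps)
    ultimately show ?thesis by argo
  qed
  have "Cauchy X"
  proof (rule metric_CauchyI)
    fix e :: real assume e: "0 < e"
    obtain N where N: "inverse (real (Suc N)) < e\<^sup>2 / 4"
      using reals_Archimedean[of "e\<^sup>2 / 4"] e by auto
    have small: "J (X n) - m < e\<^sup>2 / 4" if "n \<ge> N" for n
    proof -
      have "inverse (real (Suc n)) \<le> inverse (real (Suc N))"
        using that by (simp add: field_simps)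
      with XJ[of n] N show ?thesis by linarith
    qed
    show "\<exists>N. \<forall>m\<ge>N. \<forall>n\<ge>N. dist (X m) (X n) < e"
    proof (intro exI allI impI)
      fix i j assume "i \<ge> N" "j \<ge> N"
      have "(norm (X i - X j))\<^sup>2 < e\<^sup>2"
        using par[OF XM XM, of i j] small[OF \<open>i \<ge> N\<close>] small[OF \<open>j \<ge> N\<close>] by argo
      then show "dist (X i) (X j) < e"
        unfolding dist_norm using e by (simp add: power_less_imp_less_base)
    qed
  qed
  then obtain s where s: "X \<longlonglongrightarrow> s"
    using Cauchy_convergent_iff convergent_def by blast
  have sM: "s \<in> M"
    using M(2) XM s closed_sequentially by blast
  have "(\<lambda>n. J (X n)) \<longlonglongrightarrow> J s"
    unfolding J_def by (intro tendsto_intros f.tendsto s)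
  moreover have "(\<lambda>n. m + inverse (real (Suc n))) \<longlonglongrightarrow> m"
    by (rule LIMSEQ_inverse_real_of_nat_add)
  ultimately have "J s \<le> m"
    by (rule LIMSEQ_le) (use XJ less_imp_le in blast)
  then have s_min: "J s \<le> J x" if "x \<in> M" for x
    using m_le[OF that] by simp
  have "f v = v \<bullet> s" if v: "v \<in> M" for v
  proof -
    define d where "d = v \<bullet> s - f v"
    have quad: "0 \<le> 2 * t * d + t\<^sup>2 * (v \<bullet> v)" for t
    proof -
      have "s + t *\<^sub>R v \<in> M"
        using sM v M(1) by (intro subspace_add subspace_scale)
      from s_min[OF this] show ?thesis
        by (simp add: J_def d_def f.add f.scaleR inner_simps inner_commute power2_eq_square
            algebra_simps)
    qed
    show ?thesis
    proof (cases "v = 0")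
      case True
      then show ?thesis by (simp add: f.zero)
    next
      case False
      then have vv: "v \<bullet> v > 0" by simp
      \<comment> \<open>The chosen \<open>t\<close> minimises the quadratic; its minimum
        \<open>- d\<^sup>2 / (v \<bullet> v)\<close> is nonnegative only for
        \<open>d = 0\<close>.\<close>
      have "2 * (- d / (v \<bullet> v)) * d + (- d / (v \<bullet> v))\<^sup>2 * (v \<bullet> v) = - d\<^sup>2 / (v \<bullet> v)"
        using vv by (simp add: power2_eq_square field_simps)
      with quad[of "- d / (v \<bullet> v)"] have "d\<^sup>2 / (v \<bullet> v) \<le> 0" by simp
      then have "d = 0"
        using vv by (simp add: divide_le_0_iff)
      then show ?thesis by (simp add: d_def)
    qed
  qed
  with sM that show thesis by blast
qed

text \<open>\<open>E\<close> is the orthogonal projection onto \<open>M\<close>: \<open>E x\<close>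
  represents the functional \<open>v \<bullet> x\<close> of \<open>v\<close> on \<open>M\<close>,
  and uniqueness of the representing vector gives linearity.\<close>

lemma orthogonal_decomposition:
  fixes M :: "'a::{real_inner,complete_space} set"
  assumes "subspace M" "closed M"
  obtains E :: "'a \<Rightarrow>\<^sub>L 'a"
  where "\<And>x. E x \<in> M" "\<And>x v. v \<in> M \<Longrightarrow> v \<bullet> E x = v \<bullet> x" "\<And>x. norm (E x) \<le> norm x"
proof -
  have "\<exists>s\<in>M. \<forall>v\<in>M. v \<bullet> s = v \<bullet> x" for x :: 'a
    using riesz_on_closed_subspace[OF assms bounded_linear_inner_left, of x] by metis
  then obtain e where eM: "\<And>x. e x \<in> M" and e: "\<And>x v. v \<in> M \<Longrightarrow> v \<bullet> e x = v \<bullet> x"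
    by metis
  have eqI: "u = w" if "u \<in> M" "w \<in> M" "\<And>v. v \<in> M \<Longrightarrow> v \<bullet> u = v \<bullet> w" for u w
  proof -
    have "u - w \<in> M" using that assms(1) by (intro subspace_diff)
    from that(3)[OF this] have "(u - w) \<bullet> (u - w) = 0" by (simp add: inner_simps)
    then show ?thesis by simp
  qed
  have contr: "norm (e x) \<le> norm x" for x
  proof -
    have "norm (e x) * norm (e x) = e x \<bullet> x"
      using e[OF eM, of x x] by (simp add: dot_square_norm power2_eq_square)
    also have "\<dots> \<le> norm (e x) * norm x" by (rule norm_cauchy_schwarz)
    finally show ?thesis by (cases "e x = 0") auto
  qed
  have "bounded_linear e"
  proof (rule bounded_linear_intro[where K = 1])
    show "e (x + y) = e x + e y" for x y
      by (rule eqI) (auto simp: e inner_simps intro: eM subspace_add assms)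
    show "e (r *\<^sub>R x) = r *\<^sub>R e x" for r x
      by (rule eqI) (auto simp: e inner_simps intro: eM subspace_scale assms)
  qed (simp add: contr)
  then show thesis
    using that[of "Blinfun e"] by (simp add: bounded_linear_Blinfun_apply eM e contr)
qed

lemma adjoint_exists:
  fixes T :: "'a::{real_inner,complete_space} \<Rightarrow>\<^sub>L 'a"
  obtains S :: "'a \<Rightarrow>\<^sub>L 'a" where "\<And>x y. T x \<bullet> y = x \<bullet> S y"
proof -
  have "\<exists>s. \<forall>x. T x \<bullet> y = x \<bullet> s" for y
  proof -
    have "bounded_linear (\<lambda>x. T x \<bullet> y)"
      by (rule bounded_linear_inner_left_comp) (rule blinfun.bounded_linear_right)
    from riesz_on_closed_subspace[OF subspace_UNIV closed_UNIV this] show ?thesis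
      by (metis UNIV_I)
  qed
  then obtain s where s: "\<And>x y. T x \<bullet> y = x \<bullet> s y" by metis
  have eqI: "u = w" if "\<And>x. x \<bullet> u = x \<bullet> w" for u w :: 'a
    by (rule iffD1[OF vector_eq_ldot]) (simp add: that)
  have "bounded_linear s"
  proof (rule bounded_linear_intro[where K = "norm T"])
    show "s (x + y) = s x + s y" for x y
      by (rule eqI) (simp add: s[symmetric] inner_simps)
    show "s (r *\<^sub>R x) = r *\<^sub>R s x" for r x
      by (rule eqI) (simp add: s[symmetric] inner_simps)
    show "norm (s x) \<le> norm x * norm T" for x
    proof -
      have "norm (s x) * norm (s x) = T (s x) \<bullet> x"
        by (simp add: s dot_square_norm power2_eq_square)
      also have "\<dots> \<le> norm (T (s x)) * norm x" by (rule norm_cauchy_schwarz)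
      also have "\<dots> \<le> (norm T * norm (s x)) * norm x"
        by (intro mult_right_mono norm_blinfun norm_ge_zero)
      finally have "norm (s x) * norm (s x) \<le> norm (s x) * (norm x * norm T)"
        by (simp add: mult_ac)
      then show ?thesis by (cases "s x = 0") auto
    qed
  qed
  then show thesis
    using that[of "Blinfun s"] by (simp add: bounded_linear_Blinfun_apply s)
qed

section \<open>Reduction to the real inner product\<close>

lemma scaleC_minus_one: "scaleC (-1) (x::'a::complex_hilbert) = - x"
  using scaleC_of_real[of "-1" x] by simp

lemma inner_scaleC: "scaleC c x \<bullet> y = x \<bullet> scaleC (cnj c) (y::'a::complex_hilbert)"
proof -
  have "cinner x (scaleC (cnj c) y) = c * cinner x y"
    by (metis cinner_commute cinner_scaleC_left complex_cnj_cnj complex_cnj_mult)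
  then show ?thesis by (simp add: Re_cinner[symmetric] cinner_scaleC_left)
qed

text \<open>Multiplying the first argument by \<open>\<i>\<close> moves the imaginary part into the
  real part, so the real inner product determines \<open>cinner\<close>.\<close>

lemma cinner_eq_Complex: "cinner x y = Complex (x \<bullet> y) (- (scaleC \<i> x \<bullet> (y::'a::complex_hilbert)))"
  by (rule complex_eqI) (simp_all add: Re_cinner[symmetric] cinner_scaleC_left)

lemma norm_scaleC: "norm (scaleC c (x::'a::complex_hilbert)) = cmod c * norm x"
proof -
  have "scaleC c x \<bullet> scaleC c x = (cmod c)\<^sup>2 * (x \<bullet> x)"
    by (simp add: inner_scaleC scaleC_scaleC mult.commute[of "cnj c"] complex_norm_square[symmetric]
        scaleC_of_real flip: of_real_power)
  then have "(norm (scaleC c x))\<^sup>2 = (cmod c * norm x)\<^sup>2"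
    by (simp add: power2_norm_eq_inner power_mult_distrib)
  then show ?thesis by (simp add: power2_eq_iff_nonneg)
qed

lemma bounded_linear_scaleC: "bounded_linear (scaleC c :: 'a::complex_hilbert \<Rightarrow> 'a)"
proof (rule bounded_linear_intro[where K = "cmod c"])
  show "scaleC c (r *\<^sub>R x) = r *\<^sub>R scaleC c x" for r and x :: 'a
    by (simp add: scaleC_of_real[symmetric] scaleC_scaleC mult.commute)
qed (simp_all add: scaleC_add_right norm_scaleC mult.commute)

lemma scaleC_diff_right: "scaleC c (x - y) = scaleC c x - scaleC c (y::'a::complex_hilbert)"
  by (rule linear_diff) (rule bounded_linear.linear[OF bounded_linear_scaleC])

lemma operators_scaleC: "T \<in> operators \<Longrightarrow> blinfun_apply T (scaleC c x) = scaleC c (T x)"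
  by (simp add: operators_def)

text \<open>For complex-linear \<open>T\<close>, the imaginary part of the identity at
  \<open>x\<close> is, up to sign, its real part at \<open>scaleC \<i> x\<close>.\<close>

lemma cinner_eq_iff_inner_eq:
  assumes T: "T \<in> operators"
  shows "(\<forall>x y. cinner (blinfun_apply T x) y = cinner x (S y)) \<longleftrightarrow> (\<forall>x y. T x \<bullet> y = x \<bullet> S y)"
  (is "?L \<longleftrightarrow> ?R")
proof
  assume ?L
  then show ?R by (metis Re_cinner)
next
  assume ?R
  then show ?L
    by (simp add: cinner_eq_Complex operators_scaleC[OF T, symmetric])
qed

lemma adjoint_unique: "(\<And>x y. x \<bullet> blinfun_apply S y = x \<bullet> blinfun_apply S' y) \<Longrightarrow> S = S'"
  by (rule blinfun_eqI, rule iffD1[OF vector_eq_ldot]) simp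

lemma adj_eqI:
  assumes "T \<in> operators" "\<And>x y. blinfun_apply T x \<bullet> y = x \<bullet> blinfun_apply S y"
  shows "adj T = S"
  unfolding adj_def cinner_eq_iff_inner_eq[OF assms(1)]
proof (rule the_equality)
  fix S' assume "\<forall>x y. T x \<bullet> y = x \<bullet> blinfun_apply S' y"
  then show "S' = S" by (intro adjoint_unique) (simp flip: assms(2))
qed (simp add: assms(2))

text \<open>\<open>adj\<close> is a definite description, so existence by Riesz has to come first;
  uniqueness then identifies it.\<close>

lemma inner_adj:
  assumes "T \<in> operators"
  shows "blinfun_apply T x \<bullet> y = x \<bullet> adj T y"
proof -
  obtain S where S: "\<And>x y. T x \<bullet> y = x \<bullet> blinfun_apply S y"
    using adjoint_exists[of T] by blast
  with adj_eqI[OF assms S] show ?thesis by simp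
qed

lemma adj_in_operators:
  assumes T: "T \<in> operators"
  shows "adj T \<in> operators"
proof -
  have "adj T (scaleC c x) = scaleC c (adj T x)" for c x
  proof -
    have "v \<bullet> adj T (scaleC c x) = v \<bullet> scaleC c (adj T x)" for v
    proof -
      have "v \<bullet> adj T (scaleC c x) = scaleC (cnj c) (T v) \<bullet> x"
        unfolding inner_adj[OF T, symmetric] using inner_scaleC[of "cnj c" "T v" x] by simp
      also have "\<dots> = scaleC (cnj c) v \<bullet> adj T x"
        by (simp only: operators_scaleC[OF T, symmetric] inner_adj[OF T])
      also have "\<dots> = v \<bullet> scaleC c (adj T x)"
        using inner_scaleC[of "cnj c" v "adj T x"] by simp
      finally show ?thesis .
    qed
    then show ?thesis by (rule iffD1[OF vector_eq_ldot, rule_format])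
  qed
  then show ?thesis by (simp add: operators_def)
qed

definition symmetric_op :: "('a::real_inner \<Rightarrow>\<^sub>L 'a) \<Rightarrow> bool"
  where "symmetric_op T \<longleftrightarrow> (\<forall>x y. T x \<bullet> y = x \<bullet> T y)"

lemma symmetric_opD: "symmetric_op T \<Longrightarrow> blinfun_apply T x \<bullet> y = x \<bullet> T y"
  by (simp add: symmetric_op_def)

text \<open>The squared norm of \<open>T x\<close> is \<open>x \<bullet> T (T x)\<close>. This
  carries kernel facts from an operator over to its square root.\<close>

lemma symmetric_op_square_zero:
  assumes "symmetric_op T" "blinfun_apply T (T x) = 0"
  shows "T x = 0"
  using symmetric_opD[OF assms(1), of x "T x"] assms(2) by simp

lemma orth_projection_iff:
  "orth_projection P \<longleftrightarrow> P \<in> operators \<and> (\<forall>x. P (P x) = P x) \<and> symmetric_op P"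
proof -
  have "adj P = P \<longleftrightarrow> symmetric_op P" if "P \<in> operators"
    by (metis adj_eqI inner_adj symmetric_op_def that)
  moreover have "P o\<^sub>L P = P \<longleftrightarrow> (\<forall>x. P (P x) = P x)"
    by (metis blinfun_apply_blinfun_compose blinfun_eqI)
  ultimately show ?thesis by (auto simp: orth_projection_def)
qed

text \<open>A complex operator with real quadratic form is symmetric: polarising the vanishing form
  \<open>scaleC \<i> (T x) \<bullet> x\<close> gives an antisymmetry, and replacing \<open>y\<close>
  by \<open>scaleC \<i> y\<close> turns it into symmetry.\<close>

lemma positive_op_iff:
  "positive_op T \<longleftrightarrow> T \<in> operators \<and> symmetric_op T \<and> (\<forall>x. 0 \<le> T x \<bullet> x)"
proof -
  have "(\<forall>x. cinner (T x) x \<in> \<real>\<^sub>\<ge>\<^sub>0) \<longleftrightarrow> symmetric_op T \<and> (\<forall>x. 0 \<le> T x \<bullet> x)" (is "?L \<longleftrightarrow> ?R")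
    if T: "T \<in> operators"
  proof
    assume L: ?L
    then have pos: "0 \<le> T x \<bullet> x" and im: "scaleC \<i> (T x) \<bullet> x = 0" for x
      using complex_nonneg_Reals_iff[of "cinner (T x) x"] by (auto simp: cinner_eq_Complex)
    have anti: "scaleC \<i> (T x) \<bullet> y + scaleC \<i> (T y) \<bullet> x = 0" for x y
      using im[of "x + y"] im[of x] im[of y]
      by (simp add: blinfun.bilinear_simps scaleC_add_right inner_simps)
    have "T x \<bullet> y = x \<bullet> T y" for x y
    proof -
      have "scaleC \<i> (T x) \<bullet> scaleC \<i> y = T x \<bullet> y"
        using scaleC_of_real[of 1 y] by (simp add: inner_scaleC scaleC_scaleC)
      moreover have "scaleC \<i> (T (scaleC \<i> y)) = - T y"
        by (simp add: operators_scaleC[OF T] scaleC_scaleC scaleC_minus_one)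
      ultimately show ?thesis
        using anti[of x "scaleC \<i> y"] by (simp add: inner_commute)
    qed
    then show ?R using pos by (simp add: symmetric_op_def)
  next
    assume R: ?R
    have "scaleC \<i> (T x) \<bullet> x = 0" for x
    proof -
      have "scaleC \<i> (T x) \<bullet> x = scaleC \<i> x \<bullet> T x"
        using R by (simp add: operators_scaleC[OF T, symmetric] symmetric_op_def)
      also have "\<dots> = x \<bullet> - scaleC \<i> (T x)"
        using scaleC_scaleC[of "-1" \<i> "T x"]
        by (simp only: inner_scaleC[of \<i> x]) (simp add: scaleC_minus_one)
      also have "\<dots> = - (scaleC \<i> (T x) \<bullet> x)"
        by (metis inner_commute inner_minus_right)
      finally show ?thesis by simp
    qed
    with R show ?L by (simp add: complex_nonneg_Reals_iff cinner_eq_Complex)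
  qed
  then show ?thesis by (auto simp: positive_op_def)
qed

lemma operators_zero: "0 \<in> operators"
  using bounded_linear.linear[OF bounded_linear_scaleC] linear_0 by (force simp: operators_def)

lemma operators_id: "id_blinfun \<in> operators"
  by (simp add: operators_def)

lemma operators_add: "S \<in> operators \<Longrightarrow> T \<in> operators \<Longrightarrow> S + T \<in> operators"
  by (simp add: operators_def blinfun.bilinear_simps scaleC_add_right)

lemma operators_diff: "S \<in> operators \<Longrightarrow> T \<in> operators \<Longrightarrow> S - T \<in> operators"
  by (simp add: operators_def blinfun.bilinear_simps scaleC_diff_right)

lemma operators_compose: "S \<in> operators \<Longrightarrow> T \<in> operators \<Longrightarrow> S o\<^sub>L T \<in> operators"
  by (simp add: operators_def)

lemma operators_scaleR: "T \<in> operators \<Longrightarrow> r *\<^sub>R T \<in> operators"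
  by (simp add: operators_def blinfun.bilinear_simps
      linear_cmul[OF bounded_linear.linear[OF bounded_linear_scaleC]])

lemmas operators_intros =
  operators_zero operators_id operators_add operators_diff operators_compose operators_scaleR
  adj_in_operators

section \<open>Square roots of positive operators\<close>

text \<open>This is \<open>T\<^sup>2 \<le> K T\<close> in form language. It comes from nonnegativity
  of the form of \<open>T\<close> at \<open>x - T x / K\<close>, where the cubic term is bounded by
  applying the hypothesis at \<open>T x\<close>.\<close>

lemma positive_inner_bound:
  assumes T: "positive_op T" and K: "0 < K" "\<And>y. T y \<bullet> y \<le> K * (y \<bullet> y)"
  shows "T x \<bullet> T x \<le> K * (T x \<bullet> x)"
proof -
  define y where "y = x - (1 / K) *\<^sub>R T x"
  have sym: "T x \<bullet> y = x \<bullet> T y" and pos: "0 \<le> T x \<bullet> x" for x y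
    using T by (auto simp: positive_op_iff symmetric_op_def)
  have "T (T x) \<bullet> x = T x \<bullet> T x"
    by (simp add: sym)
  then have "T y \<bullet> y = T x \<bullet> x - 2 / K * (T x \<bullet> T x) + (1 / K)\<^sup>2 * (T (T x) \<bullet> T x)"
    by (simp add: y_def blinfun.diff_right blinfun.scaleR_right inner_diff_left inner_diff_right
        power2_eq_square algebra_simps)
  moreover have "(1 / K)\<^sup>2 * (T (T x) \<bullet> T x) \<le> (1 / K)\<^sup>2 * (K * (T x \<bullet> T x))"
    by (intro mult_left_mono K) simp
  moreover have "(1 / K)\<^sup>2 * (K * (T x \<bullet> T x)) = (T x \<bullet> T x) / K"
    using K(1) by (simp add: power2_eq_square)
  ultimately have "(T x \<bullet> T x) / K \<le> T x \<bullet> x"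
    using pos[of y] by (simp add: field_simps)
  then show ?thesis
    using K(1) by (simp add: pos_divide_le_eq mult.commute)
qed

text \<open>The summand 1 keeps the constant positive even for \<open>T = 0\<close>, so that it is a
  legitimate \<open>K\<close> above and a legitimate divisor when \<open>T\<close> is
  rescaled.\<close>

lemma inner_blinfun_le: "blinfun_apply T x \<bullet> x \<le> (norm T + 1) * (x \<bullet> x)"
proof -
  have "T x \<bullet> x \<le> norm (T x) * norm x"
    by (rule norm_cauchy_schwarz)
  also have "\<dots> \<le> (norm T * norm x) * norm x"
    by (intro mult_right_mono norm_blinfun) simp
  also have "\<dots> \<le> (norm T + 1) * (x \<bullet> x)"
    by (simp add: dot_square_norm power2_eq_square distrib_right)
  finally show ?thesis .
qed

lemma positive_inner_zero:
  assumes "positive_op T" "T x \<bullet> x = 0"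
  shows "T x = 0"
proof -
  have "0 < norm T + 1"
    by (simp add: add_nonneg_pos)
  from positive_inner_bound[OF assms(1) this inner_blinfun_le, of x] assms(2)
  have "T x \<bullet> T x \<le> 0" by simp
  then show ?thesis by (metis inner_gt_zero_iff not_less)
qed

text \<open>Writing \<open>sqrt T = 1 - Y\<close> and \<open>Z = 1 - T\<close>, the equation for \<open>Y\<close> is the fixed point equation
  \<open>Y = (Z + Y\<^sup>2) / 2\<close>. For \<open>norm Z \<le> 1\<close> the increments of the iteration are dominated by those of the
  scalar iteration with \<open>Z = 1\<close>, which is increasing and bounded.\<close>

primrec sqrt_iter :: "('a::real_normed_vector \<Rightarrow>\<^sub>L 'a) \<Rightarrow> nat \<Rightarrow> ('a \<Rightarrow>\<^sub>L 'a)" where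
  "sqrt_iter Z 0 = 0"
| "sqrt_iter Z (Suc n) = (1/2) *\<^sub>R (Z + (sqrt_iter Z n o\<^sub>L sqrt_iter Z n))"

primrec scalar_iter :: "nat \<Rightarrow> real" where
  "scalar_iter 0 = 0"
| "scalar_iter (Suc n) = (1 + (scalar_iter n)\<^sup>2) / 2"

lemma scalar_iter_bounds: "0 \<le> scalar_iter n \<and> scalar_iter n \<le> 1"
proof (induction n)
  case (Suc n)
  then have "(scalar_iter n)\<^sup>2 \<le> 1"
    by (simp add: power_le_one)
  then show ?case by simp
qed simp

lemma norm_sqrt_iter_le:
  assumes "norm Z \<le> 1"
  shows "norm (sqrt_iter Z n) \<le> scalar_iter n"
proof (induction n)
  case (Suc n)
  have "norm (Z + (sqrt_iter Z n o\<^sub>L sqrt_iter Z n)) \<le> norm Z + norm (sqrt_iter Z n) * norm (sqrt_iter Z n)"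
    by (rule order_trans[OF norm_triangle_ineq]) (simp add: norm_blinfun_compose)
  also have "\<dots> \<le> 1 + scalar_iter n * scalar_iter n"
    by (intro add_mono mult_mono Suc.IH assms) (simp_all add: scalar_iter_bounds)
  finally show ?case by (simp add: power2_eq_square)
qed simp

lemma norm_sqrt_iter_Suc_diff:
  assumes Z: "norm Z \<le> 1"
  shows "norm (sqrt_iter Z (Suc n) - sqrt_iter Z n) \<le> scalar_iter (Suc n) - scalar_iter n"
proof (induction n)
  case 0
  then show ?case using Z by simp
next
  case (Suc n)
  define A B where "A = sqrt_iter Z (Suc n)" and "B = sqrt_iter Z n"
  define a b where "a = scalar_iter (Suc n)" and "b = scalar_iter n"
  have le: "norm (A - B) \<le> a - b" "norm A \<le> a" "norm B \<le> b"
    using Suc norm_sqrt_iter_le[OF Z] unfolding A_def B_def a_def b_def by blast+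
  have nonneg: "0 \<le> a - b" "0 \<le> a"
    using le norm_ge_zero order_trans by blast+
  \<comment> \<open>The factorisation \<open>A\<^sup>2 - B\<^sup>2 = A(A - B) + (A - B)B\<close>
    holds for noncommuting factors, and its scalar counterpart is exactly twice the next scalar
    increment.\<close>
  have "sqrt_iter Z (Suc (Suc n)) - sqrt_iter Z (Suc n) = (1/2) *\<^sub>R ((A o\<^sub>L (A - B)) + ((A - B) o\<^sub>L B))"
  proof (rule blinfun_eqI)
    fix x
    have "sqrt_iter Z (Suc (Suc n)) = (1/2) *\<^sub>R (Z + (A o\<^sub>L A))"
      and "sqrt_iter Z (Suc n) = (1/2) *\<^sub>R (Z + (B o\<^sub>L B))"
      by (simp_all add: A_def B_def)
    then show "(sqrt_iter Z (Suc (Suc n)) - sqrt_iter Z (Suc n)) x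
        = ((1/2) *\<^sub>R ((A o\<^sub>L (A - B)) + ((A - B) o\<^sub>L B))) x"
      by (simp add: blinfun.add_left blinfun.diff_left blinfun.diff_right blinfun.scaleR_left
          scaleR_add_right scaleR_diff_right del: sqrt_iter.simps)
  qed
  then have "norm (sqrt_iter Z (Suc (Suc n)) - sqrt_iter Z (Suc n))
      = norm ((A o\<^sub>L (A - B)) + ((A - B) o\<^sub>L B)) / 2"
    by (simp del: sqrt_iter.simps)
  also have "norm ((A o\<^sub>L (A - B)) + ((A - B) o\<^sub>L B)) \<le> norm A * norm (A - B) + norm (A - B) * norm B"
    by (rule order_trans[OF norm_triangle_ineq]) (intro add_mono norm_blinfun_compose)
  also have "\<dots> \<le> a * (a - b) + (a - b) * b"
    by (intro add_mono mult_mono le nonneg norm_ge_zero)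
  also have "(a * (a - b) + (a - b) * b) / 2 = scalar_iter (Suc (Suc n)) - scalar_iter (Suc n)"
  proof -
    have "scalar_iter (Suc (Suc n)) = (1 + a\<^sup>2) / 2" "scalar_iter (Suc n) = (1 + b\<^sup>2) / 2"
      by (simp_all add: a_def b_def)
    then show ?thesis
      by (simp add: power2_eq_square field_simps del: scalar_iter.simps)
  qed
  finally show ?case by simp
qed

lemma norm_sqrt_iter_diff:
  assumes Z: "norm Z \<le> 1" and "m \<le> n"
  shows "norm (sqrt_iter Z n - sqrt_iter Z m) \<le> scalar_iter n - scalar_iter m"
  using \<open>m \<le> n\<close>
proof (induction n rule: dec_induct)
  case (step n)
  have "norm (sqrt_iter Z (Suc n) - sqrt_iter Z m)
      \<le> norm (sqrt_iter Z (Suc n) - sqrt_iter Z n) + norm (sqrt_iter Z n - sqrt_iter Z m)"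
    using norm_triangle_ineq[of "sqrt_iter Z (Suc n) - sqrt_iter Z n" "sqrt_iter Z n - sqrt_iter Z m"]
    by simp
  with step.IH norm_sqrt_iter_Suc_diff[OF Z, of n] show ?case by linarith
qed simp

lemma convergent_sqrt_iter:
  fixes Z :: "'a::banach \<Rightarrow>\<^sub>L 'a"
  assumes Z: "norm Z \<le> 1"
  shows "convergent (sqrt_iter Z)"
proof -
  have "incseq scalar_iter"
  proof (rule incseq_SucI)
    fix n
    \<comment> \<open>A scalar increment bounds a norm, hence it is nonnegative.\<close>
    show "scalar_iter n \<le> scalar_iter (Suc n)"
      using order_trans[OF norm_ge_zero norm_sqrt_iter_Suc_diff[OF Z, of n]] by simp
  qed
  moreover have "\<forall>n. scalar_iter n \<le> 1"
    using scalar_iter_bounds by blast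
  ultimately have "Cauchy scalar_iter"
    by (metis LIMSEQ_imp_Cauchy incseq_convergent)
  have "Cauchy (sqrt_iter Z)"
  proof (rule metric_CauchyI)
    fix e :: real assume "0 < e"
    then obtain N where N: "\<And>m n. m \<ge> N \<Longrightarrow> n \<ge> N \<Longrightarrow> dist (scalar_iter m) (scalar_iter n) < e"
      using metric_CauchyD[OF \<open>Cauchy scalar_iter\<close>] by metis
    have "dist (sqrt_iter Z n) (sqrt_iter Z m) < e" if "m \<ge> N" "n \<ge> N" "m \<le> n" for m n
      using norm_sqrt_iter_diff[OF Z \<open>m \<le> n\<close>] N[OF that(2,1)] by (simp add: dist_norm)
    then show "\<exists>N. \<forall>m\<ge>N. \<forall>n\<ge>N. dist (sqrt_iter Z m) (sqrt_iter Z n) < e"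
      by (metis dist_commute nle_le)
  qed
  then show ?thesis by (simp add: Cauchy_convergent_iff)
qed

text \<open>The commutation clause is carried along with existence because both the uniqueness of
  the root and the later reordering of products of \<open>A\<close> and the roots of
  \<open>A\<close> and \<open>P - A\<close> rest on it.\<close>

definition has_positive_root :: "('a::complex_hilbert \<Rightarrow>\<^sub>L 'a) \<Rightarrow> ('a \<Rightarrow>\<^sub>L 'a) \<Rightarrow> bool"
  where "has_positive_root T S \<longleftrightarrow> positive_op S \<and> (\<forall>x. S (S x) = T x) \<and>
    (\<forall>R. (\<forall>x. blinfun_apply R (T x) = T (R x)) \<longrightarrow> (\<forall>x. R (S x) = S (R x)))"

lemma contractive_positive_root_exists:
  assumes T: "positive_op T" and T1: "\<And>y. T y \<bullet> y \<le> y \<bullet> y"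
  shows "\<exists>S. has_positive_root T S"
proof -
  define Z where "Z = id_blinfun - T"
  have Top: "T \<in> operators" and Tsym: "symmetric_op T"
    using T by (auto simp: positive_op_iff)
  have Zop: "Z \<in> operators"
    unfolding Z_def by (intro operators_intros Top)
  have Zsym: "Z x \<bullet> y = x \<bullet> Z y" for x y
    by (simp add: Z_def blinfun.diff_left inner_diff_left inner_diff_right symmetric_opD[OF Tsym])
  \<comment> \<open>The bound at \<open>K = 1\<close> says that \<open>T x \<bullet> T x\<close> is
    at most \<open>T x \<bullet> x\<close>, so expanding the square of \<open>x - T x\<close> leaves
    at most \<open>x \<bullet> x\<close>.\<close>
  have Z1: "norm Z \<le> 1"
  proof (rule norm_blinfun_bound)
    fix x
    have "Z x \<bullet> Z x = x \<bullet> x - 2 * (T x \<bullet> x) + T x \<bullet> T x"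
      by (simp add: Z_def blinfun.diff_left inner_diff_left inner_diff_right inner_commute)
    also have "\<dots> \<le> x \<bullet> x"
      using positive_inner_bound[OF T, of 1 x] T1 T by (simp add: positive_op_iff) (smt (verit))
    finally show "norm (Z x) \<le> 1 * norm x"
      by (simp add: norm_le)
  qed simp
  obtain Y where Y: "sqrt_iter Z \<longlonglongrightarrow> Y"
    using convergent_sqrt_iter[OF Z1] by (auto simp: convergent_def)
  have Yx: "(\<lambda>n. sqrt_iter Z n x) \<longlonglongrightarrow> Y x" for x
    by (intro blinfun.tendsto Y tendsto_const)
  have Y1: "norm Y \<le> 1"
  proof (rule LIMSEQ_le_const2[OF tendsto_norm[OF Y]])
    show "\<exists>N. \<forall>n\<ge>N. norm (sqrt_iter Z n) \<le> 1"
      using norm_sqrt_iter_le[OF Z1] scalar_iter_bounds order_trans by blast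
  qed
  have "(\<lambda>n. sqrt_iter Z (Suc n)) \<longlonglongrightarrow> (1/2) *\<^sub>R (Z + (Y o\<^sub>L Y))"
    unfolding sqrt_iter.simps
    by (intro tendsto_intros bounded_bilinear.tendsto[OF bounded_bilinear_blinfun_compose] Y)
  then have Y_eq: "Y = (1/2) *\<^sub>R (Z + (Y o\<^sub>L Y))"
    using LIMSEQ_Suc[OF Y] LIMSEQ_unique by blast
  have Y_comm: "R (Y x) = Y (R x)" if R: "\<forall>x. blinfun_apply R (T x) = T (R x)" for R x
  proof -
    have "R (sqrt_iter Z n x) = sqrt_iter Z n (R x)" for n x
      by (induction n arbitrary: x) (simp_all add: R Z_def blinfun.bilinear_simps)
    with blinfun.tendsto[OF tendsto_const Yx, of R x] Yx[of "R x"] show ?thesis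
      using LIMSEQ_unique by simp
  qed
  have "sqrt_iter Z n \<in> operators" for n
    by (induction n) (simp_all add: operators_intros Zop)
  then have Yop: "Y \<in> operators"
    unfolding operators_def
    using LIMSEQ_unique[OF Yx[of "scaleC c x" for c x]]
      bounded_linear.tendsto[OF bounded_linear_scaleC Yx] by (simp add: operators_def)
  have iter_sym: "sqrt_iter Z n x \<bullet> y = x \<bullet> sqrt_iter Z n y" for n x y
    by (induction n arbitrary: x y) (simp_all add: Zsym blinfun.bilinear_simps inner_simps)
  have Ysym: "Y x \<bullet> y = x \<bullet> Y y" for x y
  proof (rule LIMSEQ_unique)
    show "(\<lambda>n. sqrt_iter Z n x \<bullet> y) \<longlonglongrightarrow> Y x \<bullet> y"
      by (intro tendsto_intros Yx)
    show "(\<lambda>n. sqrt_iter Z n x \<bullet> y) \<longlonglongrightarrow> x \<bullet> Y y"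
      unfolding iter_sym by (intro tendsto_intros Yx)
  qed
  define S where "S = id_blinfun - Y"
  have "0 \<le> S x \<bullet> x" for x
  proof -
    have "Y x \<bullet> x \<le> norm (Y x) * norm x"
      by (rule norm_cauchy_schwarz)
    also have "\<dots> \<le> (1 * norm x) * norm x"
      by (intro mult_right_mono norm_ge_zero order_trans[OF norm_blinfun] Y1)
    finally show ?thesis
      by (simp add: S_def blinfun.diff_left inner_diff_left dot_square_norm power2_eq_square)
  qed
  moreover have "S \<in> operators"
    unfolding S_def by (intro operators_intros Yop)
  moreover have "S (S x) = T x" for x
  proof -
    have "Y x = (1/2) *\<^sub>R (x - T x + Y (Y x))"
      using arg_cong[OF Y_eq, of "\<lambda>F. blinfun_apply F x"]
      by (simp add: Z_def blinfun.bilinear_simps)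
    then have "Y x + Y x = x - T x + Y (Y x)"
      by (metis scaleR_half_double scaleR_add_right)
    then show ?thesis by (simp add: S_def blinfun.bilinear_simps algebra_simps)
  qed
  moreover have "R (S x) = S (R x)" if "\<forall>x. blinfun_apply R (T x) = T (R x)" for R x
    using Y_comm[OF that] by (simp add: S_def blinfun.bilinear_simps)
  moreover have "symmetric_op S"
    by (simp add: symmetric_op_def S_def blinfun.bilinear_simps inner_simps Ysym)
  ultimately show ?thesis
    unfolding has_positive_root_def positive_op_iff by blast
qed

lemma positive_root_exists:
  assumes T: "positive_op T"
  shows "\<exists>S. has_positive_root T S"
proof -
  define K where "K = norm T + 1"
  have K: "K > 0"
    by (simp add: K_def add_nonneg_pos)
  define T' where "T' = (1/K) *\<^sub>R T"
  have T'x: "T' x = (1/K) *\<^sub>R T x" for x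
    by (simp add: T'_def blinfun.scaleR_left)
  have "T' \<in> operators"
    using T unfolding T'_def positive_op_iff by (intro operators_scaleR) blast
  then have "positive_op T'"
    using T K by (auto simp: positive_op_iff symmetric_op_def T'x)
  moreover have "T' y \<bullet> y \<le> y \<bullet> y" for y
  proof -
    have "T' y \<bullet> y = (T y \<bullet> y) / K"
      by (simp add: T'x)
    also have "\<dots> \<le> y \<bullet> y"
      using inner_blinfun_le[of T y] unfolding K_def[symmetric] pos_divide_le_eq[OF K]
      by (simp only: mult.commute)
    finally show ?thesis .
  qed
  ultimately obtain S' where S': "has_positive_root T' S'"
    using contractive_positive_root_exists by blast
  then have S'_pos: "positive_op S'" and S'_sq: "\<And>x. S' (S' x) = T' x"
    by (simp_all add: has_positive_root_def)
  define S where "S = sqrt K *\<^sub>R S'"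
  have Sx: "S x = sqrt K *\<^sub>R S' x" for x
    by (simp add: S_def blinfun.scaleR_left)
  have "S \<in> operators"
    using S'_pos unfolding S_def positive_op_iff by (intro operators_scaleR) blast
  then have "positive_op S"
    using S'_pos K by (auto simp: positive_op_iff symmetric_op_def Sx)
  moreover have "S (S x) = T x" for x
    using K by (simp add: Sx blinfun.scaleR_right S'_sq T'x)
  moreover have "R (S x) = S (R x)" if "\<forall>x. blinfun_apply R (T x) = T (R x)" for R x
  proof -
    have "\<forall>x. R (T' x) = T' (R x)"
      using that by (simp add: T'x blinfun.scaleR_right)
    then have "R (S' x) = S' (R x)"
      using S' unfolding has_positive_root_def by blast
    then show ?thesis
      by (simp add: Sx blinfun.scaleR_right)
  qed
  ultimately show ?thesis
    unfolding has_positive_root_def by blast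
qed

text \<open>\<open>S\<close> commutes with \<open>T\<close>, its square, hence with
  \<open>R\<close>. So \<open>R + S\<close> annihilates \<open>y = R x - S x\<close>; both
  nonnegative forms vanish at \<open>y\<close>, whence \<open>R y = S y = 0\<close>, and
  \<open>y \<bullet> y = x \<bullet> (R y - S y) = 0\<close>.\<close>

lemma positive_root_unique:
  assumes R: "has_positive_root T R" and S: "positive_op S" "\<And>x. S (S x) = T x"
  shows "S = R"
proof (rule blinfun_eqI)
  fix x
  have Rpos: "positive_op R" and RR: "\<And>x. R (R x) = T x"
    using R by (auto simp: has_positive_root_def)
  have SR: "S (R x) = R (S x)" for x
    using R S(2) unfolding has_positive_root_def by metis
  define y where "y = R x - S x"
  have "R y + S y = 0"
    by (simp add: y_def blinfun.diff_right RR S(2) SR)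
  then have "R y \<bullet> y + S y \<bullet> y = 0"
    by (metis inner_add_left inner_zero_left)
  moreover have "0 \<le> R y \<bullet> y" "0 \<le> S y \<bullet> y"
    using Rpos S(1) by (auto simp: positive_op_iff)
  ultimately have "R y \<bullet> y = 0" "S y \<bullet> y = 0"
    by linarith+
  then have "R y = 0" "S y = 0"
    using positive_inner_zero Rpos S(1) by blast+
  moreover have "y \<bullet> y = x \<bullet> (R y - S y)"
    using Rpos S(1) by (simp add: y_def[symmetric] inner_diff_right positive_op_iff symmetric_op_def
        flip: inner_diff_left) (simp add: y_def inner_diff_left)
  ultimately have "y = 0" by simp
  then show "S x = R x" by (simp add: y_def)
qed

lemma has_positive_root_sqrt_op:
  assumes "positive_op T"
  shows "has_positive_root T (sqrt_op T)"
proof -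
  obtain R where R: "has_positive_root T R"
    using positive_root_exists[OF assms] by blast
  have sq: "S o\<^sub>L S = T \<longleftrightarrow> (\<forall>x. S (S x) = T x)" for S
    by (metis blinfun_apply_blinfun_compose blinfun_eqI)
  have "sqrt_op T = R"
    unfolding sqrt_op_def sq
    using R positive_root_unique[OF R]
    by (intro the_equality) (auto simp: has_positive_root_def)
  with R show ?thesis by simp
qed

lemma
  assumes "positive_op T"
  shows positive_sqrt_op: "positive_op (sqrt_op T)"
    and sqrt_op_sqrt_op: "sqrt_op T (sqrt_op T x) = T x"
    and sqrt_op_commute: "(\<And>x. blinfun_apply R (T x) = T (R x)) \<Longrightarrow> R (sqrt_op T x) = sqrt_op T (R x)"
  using has_positive_root_sqrt_op[OF assms] unfolding has_positive_root_def by blast+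

section \<open>Partial isometries\<close>

text \<open>The imaginary part of \<open>cinner x y\<close> is a real inner product of
  \<open>x\<close> with a complex multiple of \<open>y\<close>, which again lies in
  \<open>S\<close>.\<close>

lemma ocompl_iff_inner:
  assumes "\<And>c y. y \<in> S \<Longrightarrow> scaleC c y \<in> S"
  shows "x \<in> ocompl S \<longleftrightarrow> (\<forall>y\<in>S. x \<bullet> y = 0)"
proof
  assume "x \<in> ocompl S"
  then show "\<forall>y\<in>S. x \<bullet> y = 0"
    by (auto simp: ocompl_def Re_cinner[symmetric])
next
  assume "\<forall>y\<in>S. x \<bullet> y = 0"
  then show "x \<in> ocompl S"
    using assms by (auto simp: ocompl_def cinner_eq_Complex inner_scaleC complex_eq_iff)
qed

lemma ocompl_kernel_iff:
  "T \<in> operators \<Longrightarrow> x \<in> ocompl (op_kernel T) \<longleftrightarrow> (\<forall>y. T y = 0 \<longrightarrow> x \<bullet> y = 0)"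
  by (subst ocompl_iff_inner)
    (auto simp: op_kernel_def operators_scaleC linear_0[OF bounded_linear.linear[OF bounded_linear_scaleC]])

lemma ocompl_range_iff:
  "T \<in> operators \<Longrightarrow> x \<in> ocompl (op_range T) \<longleftrightarrow> (\<forall>y. x \<bullet> T y = 0)"
  by (subst ocompl_iff_inner) (auto simp: op_range_def operators_scaleC[symmetric])

lemma closure_range_induct [consumes 1, case_names closed range]:
  assumes "x \<in> closure (op_range T)" "closed {x. p x}" "\<And>y. p (blinfun_apply T y)"
  shows "p x"
  using closure_minimal[of "op_range T" "{x. p x}"] assms by (auto simp: op_range_def)

lemma closed_blinfun_eq: "closed {x. blinfun_apply S x = blinfun_apply T x}"
  by (intro closed_Collect_eq continuous_intros)

lemma subspace_closure:
  fixes S :: "'a::real_normed_vector set"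
  assumes "subspace S"
  shows "subspace (closure S)"
  unfolding subspace_def
proof (intro conjI ballI allI)
  show "0 \<in> closure S"
    using subspace_0[OF assms] closure_subset by blast
next
  fix x y assume "x \<in> closure S" "y \<in> closure S"
  then obtain X Y where "\<And>n. X n \<in> S" "X \<longlonglongrightarrow> x" "\<And>n. Y n \<in> S" "Y \<longlonglongrightarrow> y"
    unfolding closure_sequential by blast
  then have "\<forall>n. X n + Y n \<in> S" "(\<lambda>n. X n + Y n) \<longlonglongrightarrow> x + y"
    by (auto intro!: subspace_add assms tendsto_intros)
  then show "x + y \<in> closure S"
    unfolding closure_sequential by (intro exI[of _ "\<lambda>n. X n + Y n"] conjI)
next
  fix c x assume "x \<in> closure S"
  then obtain X where "\<And>n. X n \<in> S" "X \<longlonglongrightarrow> x"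
    unfolding closure_sequential by blast
  then have "\<forall>n. c *\<^sub>R X n \<in> S" "(\<lambda>n. c *\<^sub>R X n) \<longlonglongrightarrow> c *\<^sub>R x"
    by (auto intro!: subspace_scale assms tendsto_intros)
  then show "c *\<^sub>R x \<in> closure S"
    unfolding closure_sequential by (intro exI[of _ "\<lambda>n. c *\<^sub>R X n"] conjI)
qed

lemma subspace_closure_range: "subspace (closure (op_range T))"
  unfolding op_range_def
  by (intro subspace_closure linear_subspace_image subspace_UNIV bounded_linear.linear
      blinfun.bounded_linear_right)

text \<open>The residual \<open>x - E x\<close> is orthogonal to the range of \<open>K\<close>,
  hence by symmetry in the kernel. A vector \<open>x\<close> orthogonal to the kernel is therefore
  orthogonal to its own residual, which must vanish.\<close>

lemma ocompl_kernel_symmetric: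
  assumes K: "K \<in> operators" "symmetric_op K"
  shows "ocompl (op_kernel K) = closure (op_range K)"
proof (intro equalityI subsetI)
  fix x assume x: "x \<in> ocompl (op_kernel K)"
  obtain E :: "'a \<Rightarrow>\<^sub>L 'a" where E: "\<And>x. E x \<in> closure (op_range K)"
    "\<And>x v. v \<in> closure (op_range K) \<Longrightarrow> v \<bullet> E x = v \<bullet> x"
    using orthogonal_decomposition[OF subspace_closure_range closed_closure, of K] by metis
  have "y \<bullet> K (x - E x) = 0" for y
  proof -
    have "K y \<in> closure (op_range K)"
      by (rule subsetD[OF closure_subset]) (simp add: op_range_def)
    then have "K y \<bullet> (x - E x) = 0"
      by (simp add: inner_diff_right E(2))
    then show ?thesis by (simp add: symmetric_opD[OF K(2)])
  qed
  then have "K (x - E x) = 0"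
    by (metis inner_eq_zero_iff)
  then have "x \<bullet> (x - E x) = 0"
    using x by (simp add: ocompl_kernel_iff[OF K(1)])
  moreover have "E x \<bullet> (x - E x) = 0"
    by (simp add: inner_diff_right E)
  ultimately have "(x - E x) \<bullet> (x - E x) = 0"
    by (simp add: inner_diff_left)
  then have "x = E x" by simp
  then show "x \<in> closure (op_range K)"
    using E(1)[of x] by simp
next
  fix x assume "x \<in> closure (op_range K)"
  then have "x \<bullet> y = 0" if "K y = 0" for y
  proof (induction rule: closure_range_induct)
    case closed
    show ?case by (intro closed_Collect_eq continuous_intros)
  next
    case (range z)
    show ?case by (simp add: symmetric_opD[OF K(2)] that)
  qed
  then show "x \<in> ocompl (op_kernel K)"
    by (simp add: ocompl_kernel_iff[OF K(1)])
qed

text \<open>The closure \<open>G\<close> of \<open>{(B x, C x)}\<close> is the graph of an isometry defined on the closure of the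
  range of \<open>B\<close>.\<close>

lemma partial_isometry_exists:
  assumes B: "B \<in> operators" "symmetric_op B" and C: "C \<in> operators"
    and BC: "\<And>x. norm (B x) = norm (C x)"
  obtains U where "partial_isometry U" "op_kernel U = op_kernel B" "\<And>x. U (B x) = C x"
    "\<And>R :: 'a::complex_hilbert \<Rightarrow>\<^sub>L 'a. (\<And>x. R (C x) = 0) \<Longrightarrow> (\<And>x. R (U x) = 0)"
proof -
  define M where "M = closure (op_range B)"
  define G where "G = closure (range (\<lambda>x. (B x, C x)))"
  have BM: "B x \<in> M" for x
    unfolding M_def by (rule subsetD[OF closure_subset]) (simp add: op_range_def)
  obtain E :: "'a \<Rightarrow>\<^sub>L 'a" where E: "\<And>x. E x \<in> M" "\<And>x v. v \<in> M \<Longrightarrow> v \<bullet> E x = v \<bullet> x"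
    "\<And>x. norm (E x) \<le> norm x"
    using orthogonal_decomposition[OF subspace_closure_range closed_closure, of B, folded M_def]
    by metis
  have M_eqI: "u = w" if "u \<in> M" "w \<in> M" "\<And>v. v \<in> M \<Longrightarrow> v \<bullet> u = v \<bullet> w" for u w
  proof -
    have "u - w \<in> M"
      unfolding M_def using that by (intro subspace_diff subspace_closure_range) (simp_all add: M_def)
    from that(3)[OF this] have "(u - w) \<bullet> (u - w) = 0" by (simp add: inner_diff_right)
    then show ?thesis by simp
  qed
  have closed_inG: "closed {p. h p \<in> G}" if "continuous_on UNIV h" for h :: "'a \<times> 'a \<Rightarrow> 'a \<times> 'a"
    using closed_vimage[OF _ that, of G] by (simp add: G_def vimage_def)
  have G_induct: "p z" if "z \<in> G" "closed {z. p z}" "\<And>x. p (B x, C x)" for p z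
    using closure_minimal[of "range (\<lambda>x. (B x, C x))" "{z. p z}"] that by (auto simp: G_def)
  have BC_G: "(B x, C x) \<in> G" for x
    unfolding G_def by (rule subsetD[OF closure_subset]) simp
  have "linear (\<lambda>x. (B x, C x))"
    by (intro bounded_linear.linear bounded_linear_Pair blinfun.bounded_linear_right)
  then have G_sub: "subspace G"
    unfolding G_def by (intro subspace_closure linear_subspace_image subspace_UNIV)
  have G_norm: "norm (snd z) = norm (fst z)" if "z \<in> G" for z
    using that
    by (rule G_induct) (auto simp: BC intro!: closed_Collect_eq continuous_intros)
  \<comment> \<open>The difference of the two pairs lies in \<open>G\<close> and has first component
    0, so its second component has norm 0.\<close>
  have G_unique: "w = w'" if "(z, w) \<in> G" "(z, w') \<in> G" for z w w'
    using G_norm[OF subspace_diff[OF G_sub that]] by simp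
  have M_scaleC: "scaleC c z \<in> M" if "z \<in> M" for c z
    using that unfolding M_def
  proof (induction rule: closure_range_induct)
    case closed
    have "continuous_on UNIV (scaleC c :: 'a \<Rightarrow> 'a)"
      by (rule linear_continuous_on[OF bounded_linear_scaleC])
    from closed_vimage[OF closed_closure this] show ?case by (simp add: vimage_def)
  next
    case (range y)
    have "scaleC c (B y) = B (scaleC c y)"
      by (simp add: operators_scaleC[OF B(1)])
    then show ?case using BM[of "scaleC c y"] by (simp add: M_def)
  qed
  have G_scaleC: "(scaleC c (fst z), scaleC c (snd z)) \<in> G" if "z \<in> G" for c z
    using that
  proof (rule G_induct)
    show "closed {z. (scaleC c (fst z), scaleC c (snd z)) \<in> G}"
      by (intro closed_inG continuous_intros
          continuous_on_compose2[OF linear_continuous_on[OF bounded_linear_scaleC, of UNIV]]) auto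
    show "(scaleC c (fst (B x, C x)), scaleC c (snd (B x, C x))) \<in> G" for x
      using BC_G[of "scaleC c x"] by (simp add: operators_scaleC B(1) C)
  qed
  have E_scaleC: "E (scaleC c x) = scaleC c (E x)" for c x
  proof (rule M_eqI)
    fix v assume "v \<in> M"
    then have "v \<bullet> E (scaleC c x) = scaleC (cnj c) v \<bullet> E x"
      by (subst (1 2) E(2)) (simp_all add: M_scaleC inner_scaleC)
    then show "v \<bullet> E (scaleC c x) = v \<bullet> scaleC c (E x)"
      by (simp add: inner_scaleC)
  qed (simp_all add: E(1) M_scaleC)
  have "\<exists>w. (z, w) \<in> G" if "z \<in> M" for z
  proof -
    \<comment> \<open>Approximate \<open>z\<close> by values of \<open>B\<close>. The matching
      values of \<open>C\<close> have the same mutual distances, so they are Cauchy and completeness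
      provides \<open>w\<close>.\<close>
    obtain X where X: "(\<lambda>n. B (X n)) \<longlonglongrightarrow> z"
    proof -
      obtain Z where Z: "\<forall>n. Z n \<in> range B" "Z \<longlonglongrightarrow> z"
        using \<open>z \<in> M\<close> unfolding M_def op_range_def closure_sequential by blast
      have "Z = (\<lambda>n. B (inv B (Z n)))"
        using Z(1) by (simp add: f_inv_into_f)
      with Z(2) that[of "\<lambda>n. inv B (Z n)"] show thesis by simp
    qed
    then have "Cauchy (\<lambda>n. B (X n))"
      by (rule LIMSEQ_imp_Cauchy)
    moreover have "dist (C (X m)) (C (X n)) = dist (B (X m)) (B (X n))" for m n
      using BC[of "X m - X n"] by (simp add: dist_norm blinfun.diff_right)
    ultimately have "Cauchy (\<lambda>n. C (X n))"
      by (simp add: Cauchy_def)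
    then obtain w where "(\<lambda>n. C (X n)) \<longlonglongrightarrow> w"
      by (auto simp: Cauchy_convergent_iff convergent_def)
    with X have "(\<lambda>n. (B (X n), C (X n))) \<longlonglongrightarrow> (z, w)"
      by (rule tendsto_Pair)
    then have "(z, w) \<in> G"
      unfolding G_def closure_sequential by (intro exI conjI allI) auto
    then show ?thesis ..
  qed
  then have "\<forall>x. \<exists>w. (E x, w) \<in> G"
    using E(1) by blast
  \<comment> \<open>Evaluating the isometry at \<open>E x\<close> instead of \<open>x\<close>
    extends it by 0 to the orthogonal complement of \<open>M\<close>.\<close>
  then obtain u where u: "\<And>x. (E x, u x) \<in> G"
    by metis
  have u_norm: "norm (u x) = norm (E x)" for x
    using G_norm[OF u] by simp
  have u_lin: "bounded_linear u"
  proof (rule bounded_linear_intro[where K = 1])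
    show "u (x + y) = u x + u y" for x y
      using subspace_add[OF G_sub u u, of x y] by (intro G_unique[OF u]) (simp add: blinfun.add_right)
    show "u (r *\<^sub>R x) = r *\<^sub>R u x" for r x
      using subspace_scale[OF G_sub u, of r x]
      by (intro G_unique[OF u]) (simp add: blinfun.scaleR_right)
  qed (simp add: u_norm E(3))
  define U where "U = Blinfun u"
  have Ux: "U x = u x" for x
    by (simp add: U_def bounded_linear_Blinfun_apply u_lin)
  have Uop: "U \<in> operators"
  proof -
    have "u (scaleC c x) = scaleC c (u x)" for c x
      using G_scaleC[OF u, of c x] by (intro G_unique[OF u]) (simp add: E_scaleC)
    then show ?thesis by (simp add: operators_def Ux)
  qed
  have ker_U: "U x = 0 \<longleftrightarrow> E x = 0" for x
    using u_norm[of x] by (auto simp: Ux)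
  have E_id: "E z = z" if "z \<in> M" for z
    by (rule M_eqI) (auto simp: E that)
  show thesis
  proof (rule that)
    show "op_kernel U = op_kernel B"
    proof -
      have "E x = 0 \<longleftrightarrow> B x = 0" for x
      proof
        assume "E x = 0"
        then have "B y \<bullet> x = 0" for y
          using E(2)[OF BM, of y x] by simp
        then have "y \<bullet> B x = 0" for y
          by (simp add: symmetric_opD[OF B(2)])
        then show "B x = 0" by (metis inner_eq_zero_iff)
      next
        assume "B x = 0"
        have "z \<bullet> x = 0" if "z \<in> M" for z
          using that unfolding M_def
        proof (induction rule: closure_range_induct)
          case closed
          show ?case by (intro closed_Collect_eq continuous_intros)
        next
          case (range z)
          show ?case by (simp add: symmetric_opD[OF B(2)] \<open>B x = 0\<close>)
        qed
        then show "E x = 0"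
          using E(2)[OF E(1), of x x] E(1) by simp
      qed
      then show ?thesis by (simp add: op_kernel_def ker_U)
    qed
    show "partial_isometry U"
      unfolding partial_isometry_def
    proof (intro conjI ballI Uop)
      fix x assume "x \<in> ocompl (op_kernel U)"
      moreover have "E (x - E x) = 0"
        by (simp add: blinfun.diff_right E_id E(1))
      ultimately have "x \<bullet> (x - E x) = 0"
        by (simp add: ocompl_kernel_iff[OF Uop] ker_U)
      moreover have "E x \<bullet> (x - E x) = 0"
        by (simp add: inner_diff_right E)
      ultimately have "(x - E x) \<bullet> (x - E x) = 0"
        by (simp add: inner_diff_left)
      then have "E x = x" by simp
      then show "norm (U x) = norm x"
        by (simp add: Ux u_norm)
    qed
    show "U (B x) = C x" for x
      unfolding Ux using BC_G[of x] by (intro G_unique[OF u]) (simp add: E_id BM)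
    \<comment> \<open>With \<open>R = P\<close> this is what places the range of \<open>U\<close>
      inside \<open>N(P)\<close>.\<close>
    show "R (U x) = 0" if "\<And>x. R (C x) = 0" for R :: "'a \<Rightarrow>\<^sub>L 'a" and x
    proof -
      have "R (snd (E x, u x)) = 0"
        by (rule G_induct[OF u])
          (auto simp: that intro!: closed_Collect_eq continuous_intros)
      then show ?thesis by (simp add: Ux)
    qed
  qed
qed

text \<open>Real polarisation: the forms at \<open>x + y\<close>, \<open>x\<close> and
  \<open>y\<close> determine the mixed term.\<close>

lemma symmetric_op_eqI:
  assumes S: "symmetric_op S" and T: "symmetric_op T"
    and eq: "\<And>x. blinfun_apply S x \<bullet> x = T x \<bullet> x"
  shows "S = T"
proof (rule blinfun_eqI, rule iffD1[OF vector_eq_rdot], rule allI)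
  fix x y
  have "S y \<bullet> x = S x \<bullet> y" "T y \<bullet> x = T x \<bullet> y"
    by (metis S T inner_commute symmetric_opD)+
  with eq[of "x + y"] eq[of x] eq[of y] show "S x \<bullet> y = T x \<bullet> y"
    by (simp add: blinfun.add_right inner_add_left inner_add_right)
qed

text \<open>Everything follows from \<open>adj U o\<^sub>L U = F\<close>, the orthogonal projection
  onto the initial space. Both sides are symmetric, and their forms agree because \<open>U\<close>
  is isometric on the range of \<open>F\<close> and vanishes on the range of
  \<open>N\<close>.\<close>

lemma
  assumes U: "partial_isometry U"
  shows partial_isometry_adj_cancel: "U (adj U (U x)) = U x"
    and adj_partial_isometry_cancel: "adj U (U (adj U x)) = adj U x"
    and adj_partial_isometry_initial: "x \<in> initial_space U \<Longrightarrow> adj U (U x) = x"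
    and adj_partial_isometry_in_initial: "adj U (U x) \<in> initial_space U"
proof -
  have Uop: "U \<in> operators" and iso: "\<And>x. x \<in> ocompl (op_kernel U) \<Longrightarrow> norm (U x) = norm x"
    using U by (auto simp: partial_isometry_def)
  have "subspace (op_kernel U)"
    by (auto simp: subspace_def op_kernel_def blinfun.bilinear_simps)
  moreover have "closed (op_kernel U)"
    unfolding op_kernel_def by (intro closed_Collect_eq continuous_intros)
  ultimately obtain N :: "'a \<Rightarrow>\<^sub>L 'a" where N: "\<And>x. N x \<in> op_kernel U"
    "\<And>x v. v \<in> op_kernel U \<Longrightarrow> v \<bullet> N x = v \<bullet> x"
    using orthogonal_decomposition by metis
  have UN: "U (N x) = 0" for x
    using N(1) by (simp add: op_kernel_def)
  define F where "F = id_blinfun - N"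
  have Fx: "F x = x - N x" for x
    by (simp add: F_def blinfun.diff_left)
  have F_orth: "F x \<bullet> v = 0" if "U v = 0" for x v
    using N(2)[of v x] that by (simp add: Fx op_kernel_def inner_diff_right inner_commute[of _ v])
  have F_in: "F x \<in> ocompl (op_kernel U)" for x
    by (simp add: ocompl_kernel_iff[OF Uop] F_orth)
  have UF: "U (F x) = U x" for x
    by (simp add: Fx blinfun.diff_right UN)
  have Fsym: "symmetric_op F"
    unfolding symmetric_op_def
  proof (intro allI)
    fix x y
    have "F x \<bullet> y = F x \<bullet> F y + F x \<bullet> N y"
      by (simp add: Fx[of y] inner_diff_right)
    moreover have "x \<bullet> F y = F x \<bullet> F y + N x \<bullet> F y"
      by (simp add: Fx[of x] inner_diff_left)
    ultimately show "F x \<bullet> y = x \<bullet> F y"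
      using F_orth[OF UN, of x y] F_orth[OF UN, of y x] by (simp add: inner_commute)
  qed
  have "adj U o\<^sub>L U = F"
  proof (rule symmetric_op_eqI[OF _ Fsym])
    show "symmetric_op (adj U o\<^sub>L U)"
      by (simp add: symmetric_op_def inner_adj[OF Uop, symmetric])
        (metis inner_adj[OF Uop] inner_commute)
    fix x
    have "(adj U o\<^sub>L U) x \<bullet> x = U (F x) \<bullet> U (F x)"
      by (simp add: UF inner_adj[OF Uop] inner_commute)
    also have "\<dots> = F x \<bullet> F x"
      using iso[OF F_in] by (simp add: dot_square_norm)
    also have "\<dots> = F x \<bullet> x"
      using F_orth[OF UN, of x x] by (simp add: Fx[of x] inner_diff_right)
    finally show "(adj U o\<^sub>L U) x \<bullet> x = F x \<bullet> x" .
  qed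
  then have adjU: "adj U (U x) = F x" for x
    by (metis blinfun_apply_blinfun_compose)
  show cancel: "U (adj U (U x)) = U x" for x
    by (simp add: adjU UF)
  show "adj U (U (adj U x)) = adj U x"
  proof (rule iffD1[OF vector_eq_ldot], rule allI)
    fix z
    show "z \<bullet> adj U (U (adj U x)) = z \<bullet> adj U x"
      by (metis cancel inner_adj[OF Uop] inner_commute)
  qed
  show "adj U (U x) \<in> initial_space U"
    by (simp add: adjU F_in initial_space_def)
  show "adj U (U x) = x" if "x \<in> initial_space U"
  proof -
    have "x \<bullet> N x = 0"
      using that by (simp add: initial_space_def ocompl_kernel_iff[OF Uop] UN)
    then have "N x \<bullet> N x = 0"
      using N(2)[OF N(1), of x x] by (simp add: inner_commute)
    then show ?thesis by (simp add: adjU Fx)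
  qed
qed

text \<open>This replaces initial spaces by kernels. To recover the kernels from their complements,
  pair \<open>x\<close> with the complement vectors \<open>K (K x)\<close> and
  \<open>adj U (U x)\<close>: the results are the squared norms of \<open>K x\<close> and
  \<open>U x\<close>.\<close>

lemma initial_space_eq_closure_range_iff:
  assumes U: "partial_isometry U" and K: "K \<in> operators" "symmetric_op K"
  shows "initial_space U = closure (op_range K) \<longleftrightarrow> op_kernel U = op_kernel K"
proof
  assume "op_kernel U = op_kernel K"
  then show "initial_space U = closure (op_range K)"
    by (simp add: initial_space_def ocompl_kernel_symmetric[OF K])
next
  assume init: "initial_space U = closure (op_range K)"
  then have eq: "ocompl (op_kernel U) = ocompl (op_kernel K)"
    by (simp add: initial_space_def ocompl_kernel_symmetric[OF K])
  have Uop: "U \<in> operators"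
    using U by (simp add: partial_isometry_def)
  have "U x = 0 \<longleftrightarrow> K x = 0" for x
  proof
    assume "U x = 0"
    have "K (K x) \<in> ocompl (op_kernel U)"
      unfolding eq ocompl_kernel_symmetric[OF K]
      by (rule subsetD[OF closure_subset]) (simp add: op_range_def)
    then have "K (K x) \<bullet> x = 0"
      using \<open>U x = 0\<close> by (simp add: ocompl_kernel_iff[OF Uop])
    then show "K x = 0"
      by (simp only: symmetric_opD[OF K(2), of "K x"] inner_eq_zero_iff)
  next
    assume "K x = 0"
    have "adj U (U x) \<in> ocompl (op_kernel K)"
      using adj_partial_isometry_in_initial[OF U] by (simp add: initial_space_def eq)
    then have "adj U (U x) \<bullet> x = 0"
      using \<open>K x = 0\<close> by (simp add: ocompl_kernel_iff[OF K(1)])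
    then have "U x \<bullet> U x = 0"
      by (simp add: inner_adj[OF Uop] inner_commute)
    then show "U x = 0" by simp
  qed
  then show "op_kernel U = op_kernel K"
    by (simp add: op_kernel_def)
qed

section \<open>Projections with a given compression\<close>

text \<open>The description of all projections \<open>H\<close> with \<open>PHP = A\<close> works
  for any \<open>A\<close> between 0 and \<open>P\<close>. \<open>Q\<close> enters later, through
  the domination of its root by \<open>P\<close> and the existence of \<open>U\<close>.\<close>

locale dominated_positive =
  fixes P A :: "'a::complex_hilbert \<Rightarrow>\<^sub>L 'a"
  assumes P: "orth_projection P" and A: "positive_op A" and PA: "positive_op (P - A)"
    and AP [simp]: "A (P x) = A x"
begin

definition a where "a = sqrt_op A"
definition b where "b = sqrt_op (P - A)"
definition K where "K = A o\<^sub>L (P - A)"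

lemma P_op: "P \<in> operators" and P_sym: "symmetric_op P" and PP [simp]: "P (P x) = P x"
  using P by (auto simp: orth_projection_iff)

lemma A_op: "A \<in> operators" and A_sym: "symmetric_op A"
  using A by (auto simp: positive_op_iff)

lemma P_A [simp]: "P (A x) = A x"
  by (rule iffD1[OF vector_eq_ldot], rule allI)
    (simp flip: symmetric_opD[OF P_sym] symmetric_opD[OF A_sym])

lemma a_pos: "positive_op a" and a_sq: "a (a x) = A x"
  and a_comm: "(\<And>x. blinfun_apply R (A x) = A (R x)) \<Longrightarrow> R (a x) = a (R x)"
  unfolding a_def using A positive_sqrt_op sqrt_op_sqrt_op sqrt_op_commute by blast+

lemma b_pos: "positive_op b" and b_sq: "b (b x) = P x - A x"
  unfolding b_def using PA positive_sqrt_op sqrt_op_sqrt_op[OF PA, of x]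
  by (auto simp: blinfun.diff_left)

lemma b_comm: "(\<And>x. blinfun_apply R (P x - A x) = P (R x) - A (R x)) \<Longrightarrow> R (b x) = b (R x)"
  unfolding b_def by (rule sqrt_op_commute[OF PA]) (simp add: blinfun.diff_left)

lemma a_op: "a \<in> operators" and a_sym: "symmetric_op a"
  and b_op: "b \<in> operators" and b_sym: "symmetric_op b"
  using a_pos b_pos by (auto simp: positive_op_iff)

lemma aP [simp]: "a (P x) = a x"
proof -
  have "a (a (x - P x)) = 0"
    by (simp add: a_sq blinfun.diff_right)
  then have "a (x - P x) = 0"
    by (rule symmetric_op_square_zero[OF a_sym])
  then show ?thesis by (simp add: blinfun.diff_right)
qed

lemma bP [simp]: "b (P x) = b x"
proof -
  have "b (b (x - P x)) = 0"
    by (simp add: b_sq blinfun.diff_right)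
  then have "b (x - P x) = 0"
    by (rule symmetric_op_square_zero[OF b_sym])
  then show ?thesis by (simp add: blinfun.diff_right)
qed

lemma Pa [simp]: "P (a x) = a x"
  by (simp add: a_comm)

lemma A_a: "A (a x) = a (A x)"
  by (simp add: a_comm)

lemma A_b: "A (b x) = b (A x)"
  by (simp add: b_comm blinfun.diff_right)

lemma a_b: "a (b x) = b (a x)"
  by (rule b_comm) (simp add: blinfun.diff_right A_a)

lemma K_apply: "K x = A x - A (A x)"
  by (simp add: K_def blinfun.diff_left blinfun.diff_right)

lemma K_op: "K \<in> operators"
  unfolding K_def by (intro operators_intros A_op P_op)

lemma K_sym: "symmetric_op K"
  by (simp add: symmetric_op_def K_apply inner_diff_left inner_diff_right symmetric_opD[OF A_sym])

lemma ab_sq: "a (b (a (b x))) = K x"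
proof -
  have "a (b (a (b x))) = a (a (b (b x)))"
    by (simp only: a_b)
  then show ?thesis
    by (simp add: a_sq b_sq K_apply blinfun.diff_right)
qed

lemma ab_sym: "symmetric_op (a o\<^sub>L b)"
  by (simp add: symmetric_op_def symmetric_opD[OF a_sym] symmetric_opD[OF b_sym] a_b)

text \<open>The product \<open>a o\<^sub>L b\<close> is symmetric with square \<open>K\<close>, so
  it plays the part of a square root of \<open>K\<close>.\<close>

lemma ker_ab: "op_kernel (a o\<^sub>L b) = op_kernel K"
proof -
  have "a (b x) = 0 \<longleftrightarrow> K x = 0" for x
  proof
    show "a (b x) = 0 \<Longrightarrow> K x = 0"
      by (simp flip: ab_sq add: blinfun.zero_right)
    show "K x = 0 \<Longrightarrow> a (b x) = 0"
      using symmetric_op_square_zero[OF ab_sym, of x] by (simp add: ab_sq)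
  qed
  then show ?thesis by (simp add: op_kernel_def)
qed

text \<open>On the kernel of \<open>K\<close> the operator \<open>A\<close> is idempotent; this is
  the form of that fact which makes \<open>W\<close> below a partial isometry.\<close>

lemma a_P_eq_a_A:
  assumes "K x = 0"
  shows "a (P x) = a (A x)"
proof -
  have "a (a (P x - A x)) = 0"
    using assms by (simp add: a_sq blinfun.diff_right K_apply)
  then have "a (P x - A x) = 0"
    by (rule symmetric_op_square_zero[OF a_sym])
  then show ?thesis by (simp add: blinfun.diff_right)
qed

end

section \<open>From the matrix to the projection\<close>

locale dilation_isometry = dominated_positive +
  fixes U :: "'a \<Rightarrow>\<^sub>L 'a"
  assumes U: "partial_isometry U" and U_init: "initial_space U = closure (op_range K)"
    and U_final: "op_range U \<subseteq> op_kernel P"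
begin

abbreviation V where "V \<equiv> adj U"

lemma U_op: "U \<in> operators"
  using U by (simp add: partial_isometry_def)

lemma V_op: "V \<in> operators"
  by (rule adj_in_operators[OF U_op])

lemma inner_V: "x \<bullet> V y = U x \<bullet> y"
  by (simp add: inner_adj[OF U_op])

lemma V_inner: "V x \<bullet> y = x \<bullet> U y"
  by (metis inner_V inner_commute)

lemmas UVU [simp] = partial_isometry_adj_cancel[OF U]
lemmas VUV [simp] = adj_partial_isometry_cancel[OF U]

lemma U_zero_iff: "U x = 0 \<longleftrightarrow> K x = 0"
  using initial_space_eq_closure_range_iff[OF U K_op K_sym] U_init
  by (auto simp: op_kernel_def set_eq_iff)

lemma VU_K: "V (U (K x)) = K x"
  by (rule adj_partial_isometry_initial[OF U], unfold U_init, rule subsetD[OF closure_subset])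
    (simp add: op_range_def)

lemma PU [simp]: "P (U x) = 0"
  using U_final by (auto simp: op_range_def op_kernel_def)

lemma aU [simp]: "a (U x) = 0" and bU [simp]: "b (U x) = 0"
  using aP[of "U x"] bP[of "U x"] by simp_all

lemma VP [simp]: "V (P x) = 0"
  by (rule iffD1[OF vector_eq_ldot], rule allI) (simp add: inner_V flip: symmetric_opD[OF P_sym])

lemma Va [simp]: "V (a x) = 0"
  by (metis Pa VP)

lemma K_minus_VU: "K (x - V (U x)) = 0"
proof -
  have "U (x - V (U x)) = 0"
    by (simp add: blinfun.diff_right)
  then show ?thesis by (simp only: U_zero_iff)
qed

text \<open>The space splits into the closed range and the kernel of \<open>K\<close>, and
  \<open>V o\<^sub>L U\<close> projects onto the first. Continuity extends agreement from the range
  to its closure.\<close>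

lemma blinfun_eq_if_eq_on_K:
  assumes range: "\<And>x. blinfun_apply S (K x) = blinfun_apply T (K x)"
    and kernel: "\<And>x. K x = 0 \<Longrightarrow> S x = T x"
  shows "S x = T x"
proof -
  have "V (U x) \<in> closure (op_range K)"
    using adj_partial_isometry_in_initial[OF U] by (simp add: U_init)
  then have "S (V (U x)) = T (V (U x))"
    by (induction rule: closure_range_induct) (simp_all add: closed_blinfun_eq range)
  moreover have "S (x - V (U x)) = T (x - V (U x))"
    by (rule kernel) (rule K_minus_VU)
  ultimately show ?thesis by (simp add: blinfun.diff_right)
qed

text \<open>An operator commuting with \<open>K\<close> preserves both the kernel and the closed
  range of \<open>K\<close>, hence commutes with the projection onto the latter.\<close>

lemma VU_commute:
  assumes R: "\<And>x. blinfun_apply R (K x) = K (R x)"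
  shows "V (U (R x)) = R (V (U x))"
proof -
  have "(V o\<^sub>L U o\<^sub>L R) x = (R o\<^sub>L V o\<^sub>L U) x"
  proof (rule blinfun_eq_if_eq_on_K)
    show "(V o\<^sub>L U o\<^sub>L R) (K x) = (R o\<^sub>L V o\<^sub>L U) (K x)" for x
      by (simp add: R VU_K)
    show "(V o\<^sub>L U o\<^sub>L R) x = (R o\<^sub>L V o\<^sub>L U) x" if "K x = 0" for x
    proof -
      have "U x = 0" "U (R x) = 0"
        using that R[of x] by (simp_all add: U_zero_iff)
      then show ?thesis by simp
    qed
  qed
  then show ?thesis by simp
qed

lemma VU_A: "V (U (A x)) = A (V (U x))"
  by (rule VU_commute) (simp add: K_apply blinfun.diff_right)

lemma VU_b: "V (U (b x)) = b (V (U x))"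
  by (rule VU_commute) (simp add: K_apply blinfun.diff_right A_b)

lemma P_VU [simp]: "P (V (U x)) = V (U (P x))"
  by (rule VU_commute[symmetric]) (simp add: K_apply blinfun.diff_right)


definition dilation where "dilation H' =
  op_matrix A (a o\<^sub>L b o\<^sub>L V) (U o\<^sub>L a o\<^sub>L b) ((U o\<^sub>L (P - A) o\<^sub>L V) + H')"

lemma U_P: "U (P x) = U x"
proof -
  have "K (x - P x) = 0"
    by (simp add: K_apply blinfun.diff_right)
  then have "U (x - P x) = 0"
    by (simp only: U_zero_iff)
  then show ?thesis by (simp add: blinfun.diff_right)
qed

lemma dilation_apply:
  "dilation H' x = A x + a (b (V x)) + U (a (b x)) + (U (P (V x)) - U (A (V x)) + H' x)"
  by (simp add: dilation_def op_matrix_def blinfun.add_left blinfun.diff_left blinfun.diff_right)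

lemma orth_projection_dilation:
  assumes H': "orth_projection H'" and H'_range: "op_range H' \<subseteq> op_kernel P \<inter> ocompl (op_range U)"
  shows "orth_projection (dilation H')" and "P (dilation H' (P x)) = A x"
proof -
  have H'op: "H' \<in> operators" and H'sym: "symmetric_op H'" and H'H': "H' (H' x) = H' x" for x
    using H' by (auto simp: orth_projection_iff)
  have PH': "P (H' x) = 0" and orth: "H' x \<bullet> U y = 0" for x y
  proof -
    have "H' x \<in> op_kernel P \<inter> ocompl (op_range U)"
      using H'_range by (auto simp: op_range_def)
    then show "P (H' x) = 0" "H' x \<bullet> U y = 0"
      by (simp_all add: op_kernel_def ocompl_range_iff[OF U_op])
  qed
  have H'P: "H' (P x) = 0" for x
    by (rule iffD1[OF vector_eq_ldot], rule allI)
      (simp add: PH' flip: symmetric_opD[OF H'sym] symmetric_opD[OF P_sym])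
  have H'U: "H' (U x) = 0" for x
    by (rule iffD1[OF vector_eq_ldot], rule allI) (simp add: orth flip: symmetric_opD[OF H'sym])
  have VH': "V (H' x) = 0" for x
    by (rule iffD1[OF vector_eq_rdot], rule allI) (simp add: V_inner orth)
  have aH': "a (H' x) = 0" for x
    using aP[of "H' x"] by (simp add: PH' blinfun.zero_right)
  have H'a: "H' (a x) = 0" for x
    using H'P[of "a x"] by simp
  define W where "W x = a x + U (b x)" for x
  \<comment> \<open>\<open>W'\<close> is the adjoint of \<open>W\<close>, so
    \<open>dilation H'\<close> will be \<open>W\<close> times its adjoint plus
    \<open>H'\<close>.\<close>
  define W' where "W' x = a x + b (V x)" for x
  \<comment> \<open>\<open>G\<close> is the initial projection of the partial isometry \<open>W\<close>.\<close>
  define G where "G x = A x + V (U (P x - A x))" for x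
  have W_add: "W (x + y) = W x + W y" and W'_add: "W' (x + y) = W' x + W' y" for x y
    by (simp_all add: W_def W'_def blinfun.add_right)
  have H_eq: "dilation H' x = W (W' x) + H' x" for x
    by (simp add: dilation_apply W_def W'_def blinfun.add_right blinfun.diff_right a_sq b_sq a_b)
  have W'W: "W' (W x) = G x" for x
    by (simp add: W_def W'_def G_def blinfun.add_right VU_b b_sq[symmetric] a_sq)
  have WG: "W (G x) = W x" for x
  proof -
    \<comment> \<open>The residual \<open>x - V (U x)\<close> lies in the kernel of
      \<open>K\<close>; on it \<open>a\<close> does not distinguish \<open>P\<close> from
      \<open>A\<close>, which after rearrangement is \<open>a (G x) = a x\<close>.\<close>
    note a_P_eq_a_A[OF K_minus_VU, of x]
    then have "a (G x) = a x"
      by (simp add: G_def blinfun.add_right blinfun.diff_right VU_A U_P algebra_simps)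
    moreover have "U (b (G x)) = U (b x)"
    proof -
      have "U (b (G x)) = U (b (A x)) + U (V (U (b (P x - A x))))"
        by (simp only: G_def blinfun.add_right VU_b)
      then show ?thesis
        by (simp add: blinfun.diff_right)
    qed
    ultimately show ?thesis by (simp add: W_def)
  qed
  have W'H': "W' (H' x) = 0" and H'W: "H' (W x) = 0" for x
    by (simp_all add: W_def W'_def aH' VH' H'a H'U blinfun.add_right blinfun.zero_right)
  have "dilation H' (dilation H' x) = dilation H' x" for x
  proof -
    have "dilation H' (dilation H' x) = W (W' (W (W' x)) + W' (H' x)) + (H' (W (W' x)) + H' (H' x))"
      by (simp only: H_eq W'_add W_add blinfun.add_right ac_simps)
    also have "\<dots> = W (W' x) + H' x"
      by (simp only: W'W W'H' H'W H'H' add_0_left add_0_right WG)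
    finally show ?thesis by (simp only: H_eq)
  qed
  moreover have "symmetric_op (dilation H')"
  proof -
    have "W x \<bullet> y = x \<bullet> W' y" and "W' x \<bullet> y = x \<bullet> W y" for x y
      by (simp_all add: W_def W'_def inner_add_left inner_add_right symmetric_opD[OF a_sym]
          symmetric_opD[OF b_sym] V_inner flip: inner_V)
    then show ?thesis
      by (simp add: symmetric_op_def H_eq inner_add_left inner_add_right symmetric_opD[OF H'sym])
  qed
  moreover have "dilation H' \<in> operators"
    unfolding dilation_def op_matrix_def
    by (intro operators_intros A_op a_op b_op P_op U_op V_op H'op)
  ultimately show "orth_projection (dilation H')"
    by (simp add: orth_projection_iff)
  show "P (dilation H' (P x)) = A x"
    by (simp add: dilation_apply H'P blinfun.add_right blinfun.diff_right blinfun.zero_right)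
qed

end

section \<open>From the projection to the matrix\<close>

context dominated_positive
begin

text \<open>It serves twice: as the polar decomposition of the corner of a given solution, with
  \<open>B = a o\<^sub>L b\<close>, and to obtain some \<open>U\<close> from the corner of
  \<open>Q\<close>, with another \<open>B\<close> having the same kernel as
  \<open>K\<close>.\<close>

lemma dilation_isometry_from_norm_eq:
  assumes B: "B \<in> operators" "symmetric_op B" "op_kernel B = op_kernel K"
    and C: "C \<in> operators" "\<And>x. P (C x) = 0" and BC: "\<And>x. norm (B x) = norm (C x)"
  obtains U where "dilation_isometry P A U" "\<And>x. U (B x) = C x"
proof -
  obtain U where U: "partial_isometry U" "op_kernel U = op_kernel B" "\<And>x. U (B x) = C x"
    "\<And>x. P (U x) = 0"
    using partial_isometry_exists[OF B(1,2) C(1) BC] C(2) by metis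
  have "initial_space U = closure (op_range K)"
    using initial_space_eq_closure_range_iff[OF U(1) K_op K_sym] U(2) B(3) by simp
  then have "dilation_isometry P A U"
    by unfold_locales (auto simp: U op_range_def op_kernel_def)
  with U(3) that show thesis by blast
qed

lemma projection_is_dilation:
  assumes H: "orth_projection H" and PHP: "\<And>x. P (H (P x)) = A x"
  obtains U H' where "dilation_isometry P A U" "orth_projection H'"
    "op_range H' \<subseteq> op_kernel P \<inter> ocompl (op_range U)"
    "H = dilation_isometry.dilation P A U H'"
proof -
  have H_op: "H \<in> operators" and H_sym: "symmetric_op H" and HH: "H (H x) = H x" for x
    using H by (auto simp: orth_projection_iff)
  have PHA: "P (H (A x)) = A (A x)" for x
    using PHP[of "A x"] by simp
  \<comment> \<open>Since \<open>PHP = A\<close>, this is the lower left corner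
    \<open>(1 - P)HP\<close>.\<close>
  define C where "C = (H o\<^sub>L P) - A"
  have Cx: "C x = H (P x) - A x" for x
    by (simp add: C_def blinfun.diff_left)
  have C_op: "C \<in> operators"
    unfolding C_def by (intro operators_intros H_op P_op A_op)
  have PC: "P (C x) = 0" for x
    by (simp add: Cx blinfun.diff_right PHP)
  have C_norm: "norm ((a o\<^sub>L b) x) = norm (C x)" for x
  proof -
    have "H (P x) \<bullet> H (P x) = A x \<bullet> x"
      by (metis HH PHP H_sym P_sym symmetric_opD)
    moreover have "H (P x) \<bullet> A x = A x \<bullet> A x"
      by (metis P_A PHP P_sym symmetric_opD)
    moreover have "A x \<bullet> A x = A (A x) \<bullet> x"
      by (simp add: symmetric_opD[OF A_sym])
    ultimately have "C x \<bullet> C x = K x \<bullet> x"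
      by (simp add: Cx K_apply inner_diff_left inner_diff_right inner_commute[of "A x" "H (P x)"])
    moreover have "(a o\<^sub>L b) x \<bullet> (a o\<^sub>L b) x = K x \<bullet> x"
      using symmetric_opD[OF ab_sym, of "(a o\<^sub>L b) x" x] by (simp add: ab_sq)
    ultimately show ?thesis by (simp add: norm_eq_sqrt_inner)
  qed
  have "a o\<^sub>L b \<in> operators"
    by (intro operators_intros a_op b_op)
  from dilation_isometry_from_norm_eq[OF this ab_sym ker_ab C_op PC C_norm]
  obtain U where U: "dilation_isometry P A U" and U_C: "\<And>x. U ((a o\<^sub>L b) x) = C x"
    by blast
  interpret dilation_isometry P A U by fact
  have U_ab: "U (a (b x)) = C x" for x
    using U_C[of x] by simp
  \<comment> \<open>The lower right corner \<open>(1 - P)H(1 - P)\<close>.\<close>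
  define D where "D x = H (x - P x) - P (H (x - P x))" for x
  have D_eq: "D x = ((H - (H o\<^sub>L P)) - (P o\<^sub>L (H - (H o\<^sub>L P)))) x" for x
    by (simp add: D_def blinfun.diff_left blinfun.diff_right)
  have D_lin: "D (x - y) = D x - D y" for x y
    by (simp add: D_eq blinfun.diff_right)
  have PD: "P (D x) = 0" for x
    by (simp add: D_def blinfun.diff_right)
  have D_sym: "D x \<bullet> y = x \<bullet> D y" for x y
    by (simp add: D_def blinfun.diff_right inner_diff_left inner_diff_right
        symmetric_opD[OF H_sym] symmetric_opD[OF P_sym])
  \<comment> \<open>The upper right corner is the adjoint of the lower left one,
    \<open>C = U a b\<close>.\<close>
  have PH_compl: "P (H (x - P x)) = a (b (V x))" for x
  proof (rule iffD1[OF vector_eq_rdot], rule allI)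
    fix y
    have "P (H (x - P x)) \<bullet> y = (x - P x) \<bullet> (C y + A y)"
      by (simp add: symmetric_opD[OF P_sym] symmetric_opD[OF H_sym] Cx)
    also have "\<dots> = x \<bullet> (C y + A y) - x \<bullet> P (C y + A y)"
      by (simp add: inner_diff_left symmetric_opD[OF P_sym])
    also have "\<dots> = x \<bullet> U (b (a y))"
      by (simp add: blinfun.add_right PC U_ab[symmetric] inner_add_right a_b)
    also have "\<dots> = a (b (V x)) \<bullet> y"
      by (simp add: symmetric_opD[OF a_sym] symmetric_opD[OF b_sym] V_inner)
    finally show "P (H (x - P x)) \<bullet> y = a (b (V x)) \<bullet> y" .
  qed
  have H_split: "H x = A x + a (b (V x)) + U (a (b x)) + D x" for x
    by (simp add: U_ab Cx D_def PH_compl[symmetric] blinfun.diff_right)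
  \<comment> \<open>The lower left entry of \<open>H\<^sup>2 = H\<close>.\<close>
  have DC: "D (C x) = C (P x - A x)" for x
    by (simp add: D_def PC Cx HH PHP PHA blinfun.diff_right)
  have DU: "D (U x) = U (P x - A x)" for x
  proof -
    \<comment> \<open>On the range of \<open>K\<close>, write \<open>K\<close> as the square of
      \<open>a o\<^sub>L b\<close> and use \<open>DC\<close>; on its kernel both sides vanish,
      because \<open>P - A\<close> preserves that kernel. Density does the rest.\<close>
    have "(((H - (H o\<^sub>L P)) - (P o\<^sub>L (H - (H o\<^sub>L P)))) o\<^sub>L U) x = (U o\<^sub>L (P - A)) x"
    proof (rule blinfun_eq_if_eq_on_K)
      fix x
      have "D (U (K x)) = U (P (K x) - A (K x))"
        unfolding ab_sq[symmetric] U_ab DC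
        by (simp add: U_ab[symmetric] blinfun.diff_right A_a A_b)
      then show "(((H - (H o\<^sub>L P)) - (P o\<^sub>L (H - (H o\<^sub>L P)))) o\<^sub>L U) (K x) = (U o\<^sub>L (P - A)) (K x)"
        by (simp add: D_eq blinfun.diff_left)
    next
      fix x assume "K x = 0"
      then have "K (P x - A x) = 0"
        by (simp add: K_apply blinfun.diff_right)
      then have "U x = 0" "U (P x - A x) = 0"
        using \<open>K x = 0\<close> by (simp_all only: U_zero_iff)
      then show "(((H - (H o\<^sub>L P)) - (P o\<^sub>L (H - (H o\<^sub>L P)))) o\<^sub>L U) x = (U o\<^sub>L (P - A)) x"
        by (simp add: blinfun.diff_left)
    qed
    then show ?thesis
      by (simp add: D_eq blinfun.diff_left)
  qed
  have VD: "V (D x) = P (V x) - A (V x)" for x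
    by (rule iffD1[OF vector_eq_rdot], rule allI)
      (simp add: V_inner D_sym DU blinfun.diff_right inner_diff_left inner_diff_right
        symmetric_opD[OF P_sym] symmetric_opD[OF A_sym])
  have PV: "P (V x) = V x" for x
    using P_VU[of "V x"] by (simp add: U_P)
  \<comment> \<open>The lower right entry of \<open>H\<^sup>2 = H\<close>: the product of
    \<open>C\<close> with its adjoint is \<open>U K V\<close>.\<close>
  have DD: "D (D x) = D x - U (K (V x))" for x
  proof -
    define n where "n = x - P x"
    have Hn: "H n = a (b (V x)) + D x"
      using PH_compl[of x] by (simp add: D_def n_def)
    have "H (a (b (V x))) = C (a (b (V x))) + A (a (b (V x)))"
      by (simp add: Cx)
    then have "H (H n) = C (a (b (V x))) + A (a (b (V x))) + H (D x)"
      by (simp add: Hn blinfun.add_right)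
    then have eq: "a (b (V x)) + D x = C (a (b (V x))) + A (a (b (V x))) + H (D x)"
      using HH[of n] by (simp only: Hn)
    then have "P (a (b (V x)) + D x) = P (C (a (b (V x))) + A (a (b (V x))) + H (D x))"
      by (rule arg_cong)
    then have "a (b (V x)) = A (a (b (V x))) + P (H (D x))"
      by (simp only: blinfun.add_right PC PD Pa P_A add_0_left add_0_right)
    moreover have "q + d = c + r + h \<Longrightarrow> q = r + p \<Longrightarrow> d = c + (h - p)" for q d c r h p :: 'a
      by (simp add: algebra_simps)
    ultimately have "D x = C (a (b (V x))) + (H (D x) - P (H (D x)))"
      using eq by blast
    moreover have "H (D x) - P (H (D x)) = D (D x)"
      by (simp add: D_def[of "D x"] PD)
    moreover have "C (a (b (V x))) = U (K (V x))"
      by (simp add: U_ab[symmetric] ab_sq)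
    ultimately show ?thesis
      by (metis add_diff_cancel_left')
  qed
  define H' where "H' = (H - (H o\<^sub>L P)) - (P o\<^sub>L (H - (H o\<^sub>L P))) - (U o\<^sub>L (P - A) o\<^sub>L V)"
  have H'x: "H' x = D x - U (V x - A (V x))" for x
    by (simp add: H'_def D_eq blinfun.diff_left PV)
  have VH': "V (H' x) = 0" for x
    by (simp add: H'x VD PV blinfun.diff_right VU_A)
  have H'_op: "H' \<in> operators"
    unfolding H'_def by (intro operators_intros H_op P_op A_op U_op V_op)
  have "H' (H' x) = H' x" for x
  proof -
    have "H' (H' x) = D (D x) - D (U (V x - A (V x)))"
      using VH'[of x] by (simp add: H'x[of "H' x"]) (simp add: H'x D_lin)
    also have "\<dots> = D x - U (V x - A (V x))"
      by (simp add: DD DU D_lin K_apply PV blinfun.diff_right)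
    finally show ?thesis by (simp add: H'x)
  qed
  moreover have "symmetric_op H'"
    unfolding symmetric_op_def H'x
    by (simp add: inner_diff_left inner_diff_right D_sym blinfun.diff_right inner_V[symmetric]
        V_inner[symmetric] symmetric_opD[OF A_sym])
  ultimately have "orth_projection H'"
    using H'_op by (simp add: orth_projection_iff)
  moreover have "op_range H' \<subseteq> op_kernel P \<inter> ocompl (op_range U)"
  proof -
    have "P (H' x) = 0" for x
      by (simp add: H'x blinfun.diff_right PD)
    moreover have "H' x \<bullet> U y = 0" for x y
      using VH'[of x] by (simp flip: V_inner)
    ultimately show ?thesis
      by (auto simp: op_range_def[of H'] op_kernel_def ocompl_range_iff[OF U_op])
  qed
  moreover have "H = dilation H'"
    by (rule blinfun_eqI) (simp add: dilation_apply H'x H_split PV blinfun.diff_right)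
  ultimately show thesis
    using that dilation_isometry_axioms by blast
qed

end

section \<open>The root of the compression of Q, and an admissible partial isometry\<close>

lemma
  assumes P: "orth_projection P" and Q: "orth_projection Q"
  shows sqrt_compression_dominated: "dominated_positive P (sqrt_op (P o\<^sub>L Q o\<^sub>L P))"
    and sqrt_compression_square: "sqrt_op (P o\<^sub>L Q o\<^sub>L P) (sqrt_op (P o\<^sub>L Q o\<^sub>L P) x) = P (Q (P x))"
proof -
  define A where "A = sqrt_op (P o\<^sub>L Q o\<^sub>L P)"
  have P_op: "P \<in> operators" and P_sym: "symmetric_op P" and PP: "P (P x) = P x" for x
    using P by (auto simp: orth_projection_iff)
  have Q_op: "Q \<in> operators" and Q_sym: "symmetric_op Q" and QQ: "Q (Q x) = Q x" for x
    using Q by (auto simp: orth_projection_iff)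
  have contraction: "R x \<bullet> R x \<le> x \<bullet> x" if R: "orth_projection R" for R :: "'a \<Rightarrow>\<^sub>L 'a" and x
  proof -
    have RR: "R x \<bullet> R x = R x \<bullet> x"
      using R by (simp add: orth_projection_iff) (metis symmetric_opD)
    have "0 \<le> (x - R x) \<bullet> (x - R x)" by simp
    then show ?thesis
      using RR by (simp add: inner_diff_left inner_diff_right inner_commute)
  qed
  have PQP_inner: "P (Q (P x)) \<bullet> x = Q (P x) \<bullet> Q (P x)" for x
    by (metis P_sym QQ Q_sym symmetric_opD)
  have pos: "positive_op (P o\<^sub>L Q o\<^sub>L P)"
    unfolding positive_op_iff
  proof (intro conjI allI operators_intros P_op Q_op)
    show "symmetric_op (P o\<^sub>L Q o\<^sub>L P)"
      by (simp add: symmetric_op_def symmetric_opD[OF P_sym] symmetric_opD[OF Q_sym])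
    show "0 \<le> (P o\<^sub>L Q o\<^sub>L P) x \<bullet> x" for x
      by (simp add: PQP_inner)
  qed
  have A: "positive_op A" and AA: "A (A x) = P (Q (P x))" for x
    using positive_sqrt_op[OF pos] sqrt_op_sqrt_op[OF pos] by (simp_all add: A_def)
  have A_op: "A \<in> operators" and A_sym: "symmetric_op A"
    using A by (auto simp: positive_op_iff)
  have AP: "A (P x) = A x" for x
  proof -
    have "A (A (x - P x)) = 0"
      by (simp add: AA blinfun.diff_right PP)
    then have "A (x - P x) = 0"
      by (rule symmetric_op_square_zero[OF A_sym])
    then show ?thesis by (simp add: blinfun.diff_right)
  qed
  \<comment> \<open>Contractivity of \<open>Q\<close> gives
    \<open>norm (A x) \<le> norm (P x)\<close>; Cauchy-Schwarz for \<open>A x\<close> and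
    \<open>P x\<close> then turns this comparison of squares into \<open>A \<le> P\<close>.\<close>
  have "A x \<bullet> x \<le> P x \<bullet> x" for x
  proof -
    have "A x \<bullet> A x = P (Q (P x)) \<bullet> x"
      by (simp add: symmetric_opD[OF A_sym] inner_commute flip: AA)
    also have "\<dots> \<le> P x \<bullet> P x"
      using contraction[OF Q, of "P x"] by (simp add: PQP_inner)
    finally have "norm (A x) \<le> norm (P x)"
      by (simp add: norm_le)
    have "A x \<bullet> x = A x \<bullet> P x"
      by (metis AP A_sym symmetric_opD)
    also have "\<dots> \<le> norm (A x) * norm (P x)"
      by (rule norm_cauchy_schwarz)
    also have "\<dots> \<le> norm (P x) * norm (P x)"
      by (intro mult_right_mono \<open>norm (A x) \<le> norm (P x)\<close> norm_ge_zero)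
    also have "\<dots> = P x \<bullet> P x"
      by (simp add: dot_square_norm power2_eq_square)
    also have "\<dots> = P x \<bullet> x"
      by (metis PP P_sym symmetric_opD)
    finally show ?thesis .
  qed
  moreover have "P - A \<in> operators"
    by (intro operators_intros P_op A_op)
  moreover have "symmetric_op (P - A)"
    by (simp add: symmetric_op_def blinfun.diff_left inner_diff_left inner_diff_right
        symmetric_opD[OF A_sym] symmetric_opD[OF P_sym])
  ultimately have "positive_op (P - A)"
    by (simp add: positive_op_iff blinfun.diff_left inner_diff_left)
  with P A AP show "dominated_positive P (sqrt_op (P o\<^sub>L Q o\<^sub>L P))"
    unfolding A_def[symmetric] by unfold_locales
  show "sqrt_op (P o\<^sub>L Q o\<^sub>L P) (sqrt_op (P o\<^sub>L Q o\<^sub>L P) x) = P (Q (P x))"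
    using AA by (simp add: A_def)
qed

lemma dilation_isometry_exists:
  assumes P: "orth_projection P" and Q: "orth_projection Q"
  obtains U where "dilation_isometry P (sqrt_op (P o\<^sub>L Q o\<^sub>L P)) U"
proof -
  define A where "A = sqrt_op (P o\<^sub>L Q o\<^sub>L P)"
  interpret dominated_positive P A
    unfolding A_def using P Q by (rule sqrt_compression_dominated)
  have AA: "A (A x) = P (Q (P x))" for x
    unfolding A_def using P Q by (rule sqrt_compression_square)
  have Q_op: "Q \<in> operators" and Q_sym: "symmetric_op Q" and QQ: "Q (Q x) = Q x" for x
    using Q by (auto simp: orth_projection_iff)
  define C where "C = (Q o\<^sub>L P) - (P o\<^sub>L Q o\<^sub>L P)"
  have Cx: "C x = Q (P x) - A (A x)" for x
    by (simp add: C_def blinfun.diff_left AA)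
  have C_op: "C \<in> operators"
    unfolding C_def by (intro operators_intros Q_op P_op)
  have PC: "P (C x) = 0" for x
    by (simp add: Cx blinfun.diff_right AA)
  \<comment> \<open>\<open>T\<close> is \<open>adj C o\<^sub>L C\<close>, computed from
    \<open>Q\<^sup>2 = Q\<close> and \<open>PQP = A\<^sup>2\<close>; its root \<open>B\<close> is
    the modulus of \<open>C\<close>.\<close>
  define T where "T = (A o\<^sub>L A) - (A o\<^sub>L A o\<^sub>L A o\<^sub>L A)"
  have Tx: "T x = A (A x) - A (A (A (A x)))" for x
    by (simp add: T_def blinfun.diff_left)
  have T_op: "T \<in> operators"
    unfolding T_def by (intro operators_intros A_op)
  have T_sym: "symmetric_op T"
    by (simp add: symmetric_op_def Tx inner_diff_left inner_diff_right symmetric_opD[OF A_sym])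
  have T_inner: "T x \<bullet> x = C x \<bullet> C x" for x
  proof -
    have "Q (P x) \<bullet> Q (P x) = A (A x) \<bullet> x"
      by (metis AA QQ Q_sym P_sym symmetric_opD)
    moreover have "Q (P x) \<bullet> A (A x) = A (A x) \<bullet> A (A x)"
      by (metis AA P_A P_sym symmetric_opD)
    moreover have "A (A x) \<bullet> A (A x) = A (A (A (A x))) \<bullet> x"
      by (simp add: symmetric_opD[OF A_sym])
    ultimately show ?thesis
      by (simp add: Cx Tx inner_diff_left inner_diff_right inner_commute[of "A (A x)" "Q (P x)"])
  qed
  have T_pos: "positive_op T"
    using T_op T_sym by (simp add: positive_op_iff T_inner)
  define B where "B = sqrt_op T"
  have B_pos: "positive_op B" and BB: "B (B x) = T x" for x
    using positive_sqrt_op[OF T_pos] sqrt_op_sqrt_op[OF T_pos] by (simp_all add: B_def)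
  have B_op: "B \<in> operators" and B_sym: "symmetric_op B"
    using B_pos by (auto simp: positive_op_iff)
  have BC: "norm (B x) = norm (C x)" for x
  proof -
    have "B x \<bullet> B x = T x \<bullet> x"
      by (simp add: symmetric_opD[OF B_sym] inner_commute flip: BB)
    then show ?thesis by (simp add: T_inner norm_eq_sqrt_inner)
  qed
  have "B x = 0 \<longleftrightarrow> K x = 0" for x
  proof
    assume "B x = 0"
    then have "T x = 0"
      using BB[of x] by (simp add: blinfun.zero_right)
    \<comment> \<open>The factorisation \<open>T = (A + A\<^sup>2)K\<close> yields
      \<open>A y \<bullet> A y + A y \<bullet> y = 0\<close>, so \<open>A y = 0\<close>. As
      \<open>y = A (x - A x)\<close> lies in the range of the symmetric \<open>A\<close>, it is
      orthogonal to itself.\<close>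
    define y where "y = K x"
    have "A (A y) + A y = T x"
      by (simp add: y_def Tx K_apply blinfun.diff_right)
    with \<open>T x = 0\<close> have "A (A y) \<bullet> y + A y \<bullet> y = 0"
      by (simp flip: inner_add_left)
    moreover have "A (A y) \<bullet> y = A y \<bullet> A y"
      by (simp add: symmetric_opD[OF A_sym])
    moreover have "0 \<le> A y \<bullet> y"
      using A by (simp add: positive_op_iff)
    ultimately have "A y \<bullet> A y \<le> 0" by linarith
    then have "A y = 0"
      by (metis inner_gt_zero_iff not_less)
    moreover have "y \<bullet> y = (x - A x) \<bullet> A y"
    proof -
      have "A (x - A x) = y"
        by (simp add: y_def K_apply blinfun.diff_right)
      with symmetric_opD[OF A_sym, of "x - A x" y] show ?thesis by simp
    qed
    ultimately show "K x = 0"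
      by (simp add: y_def)
  next
    assume "K x = 0"
    have "T x = A (K x) + A (A (K x))"
      by (simp add: Tx K_apply blinfun.diff_right)
    then have "B (B x) = 0"
      using \<open>K x = 0\<close> by (simp add: BB blinfun.zero_right)
    then show "B x = 0"
      by (rule symmetric_op_square_zero[OF B_sym])
  qed
  then have "op_kernel B = op_kernel K"
    by (simp add: op_kernel_def)
  from dilation_isometry_from_norm_eq[OF B_op B_sym this C_op PC BC] that show thesis
    unfolding A_def by blast
qed

lemma orth_projection_zero: "orth_projection 0"
  by (simp add: orth_projection_iff operators_zero symmetric_op_def)

theorem corollary4p7:
  fixes P Q :: "'a::complex_hilbert \<Rightarrow>\<^sub>L 'a"
  assumes "orth_projection P" and "orth_projection Q"
  shows "(\<exists>H. orth_projection H \<and> sqrt_op (P o\<^sub>L Q o\<^sub>L P) = P o\<^sub>L H o\<^sub>L P) \<and>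
    (let A = sqrt_op (P o\<^sub>L Q o\<^sub>L P) in
      {H. orth_projection H \<and> sqrt_op (P o\<^sub>L Q o\<^sub>L P) = P o\<^sub>L H o\<^sub>L P} =
      {op_matrix
         A                                        (sqrt_op A o\<^sub>L sqrt_op (P - A) o\<^sub>L adj U)
         (U o\<^sub>L sqrt_op A o\<^sub>L sqrt_op (P - A))    ((U o\<^sub>L (P - A) o\<^sub>L adj U) + H') | U H'.
       partial_isometry U \<and>
       initial_space U = closure (op_range (A o\<^sub>L (P - A))) \<and>
       final_space U \<subseteq> op_kernel P \<and>
       orth_projection H' \<and>
       op_range H' \<subseteq> op_kernel P \<inter> ocompl (op_range U)})"
proof -
  define A where "A = sqrt_op (P o\<^sub>L Q o\<^sub>L P)"
  interpret dominated_positive P A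
    unfolding A_def using assms by (rule sqrt_compression_dominated)
  have solution_iff: "A = P o\<^sub>L H o\<^sub>L P \<longleftrightarrow> (\<forall>x. P (H (P x)) = A x)" for H
    by (auto intro: blinfun_eqI)
  have isometry_iff: "dilation_isometry P A U \<longleftrightarrow> partial_isometry U \<and>
      initial_space U = closure (op_range (A o\<^sub>L (P - A))) \<and> final_space U \<subseteq> op_kernel P" for U
    by (simp add: dilation_isometry_def dilation_isometry_axioms_def dominated_positive_axioms
        K_def final_space_def)
  define admissible where "admissible U H' \<longleftrightarrow> dilation_isometry P A U \<and> orth_projection H' \<and>
      op_range H' \<subseteq> op_kernel P \<inter> ocompl (op_range U)" for U H'
  define D where "D U H' = op_matrix A (sqrt_op A o\<^sub>L sqrt_op (P - A) o\<^sub>L adj U)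
      (U o\<^sub>L sqrt_op A o\<^sub>L sqrt_op (P - A)) ((U o\<^sub>L (P - A) o\<^sub>L adj U) + H')" for U H'
  have D_eq: "D U H' = dilation_isometry.dilation P A U H'" if "dilation_isometry P A U" for U H'
    using dilation_isometry.dilation_def[OF that] by (simp add: D_def a_def b_def)
  have sol: "orth_projection (D U H') \<and> A = P o\<^sub>L D U H' o\<^sub>L P" if "admissible U H'" for U H'
    using that dilation_isometry.orth_projection_dilation[of P A U H']
    by (simp add: admissible_def D_eq solution_iff)
  have "\<exists>U H'. H = D U H' \<and> admissible U H'"
    if "orth_projection H" "A = P o\<^sub>L H o\<^sub>L P" for H
    using projection_is_dilation[of H thesis for thesis] that
    by (metis D_eq admissible_def solution_iff)
  with sol have "{H. orth_projection H \<and> A = P o\<^sub>L H o\<^sub>L P} = {D U H' | U H'. admissible U H'}"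
    by blast
  moreover have "\<exists>H. orth_projection H \<and> A = P o\<^sub>L H o\<^sub>L P"
  proof -
    obtain U where "dilation_isometry P A U"
      using dilation_isometry_exists[OF assms] unfolding A_def by blast
    then have "admissible U 0"
      by (auto simp: admissible_def orth_projection_zero op_range_def[of 0] op_kernel_def
          ocompl_range_iff[OF dilation_isometry.U_op])
    with sol show ?thesis by blast
  qed
  ultimately show ?thesis
    unfolding Let_def A_def[symmetric] by (simp add: admissible_def D_def isometry_iff conj_assoc)
qed

end
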